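(* Suppose $G_0(0)=H_0(0)=0$ and that no edge of $\mathcal N_{\mathcal G}$ is parallel to an edge of $\mathcal N_{\mathcal H}$, i.e. $\mathfrak S(\mathcal G)\cap\mathfrak S(\mathcal H)=\emptyset$ (condition (NP)). Suppose further that either (a) $j_{s(\mathcal G)}+\tilde j_{s(\mathcal H)}>0$ and conditions (P1) and (Q) hold, or (b) $j_{s(\mathcal G)}=\tilde j_{s(\mathcal H)}=0$, conditions (P2), (Q) and (S) hold, and one of conditions (H1), (H2), (H3), (H4) holds (all conditions are stated in the context). Then $$N(\mathcal G)=\Xi(\mathcal A(\mathcal G),\mathcal A_j(\mathcal G))\quad\text{and}\quad N(\mathcal H)=\Xi(\mathcal A(\mathcal H),\mathcal A_j(\mathcal H)).$$
   Context: **Vector field.** Let $\mathcal X=\sum_{k\ge m}X_k$ and $\mathcal Y=\sum_{k\ge m}Y_k$ be real analytic near $(0,0)\in\mathbb R^2$, where $X_k,Y_k$ are homogeneous polynomials of degree $k$, $m\ge 2$, $X_m^2+Y_m^2\not\equiv 0$, and the origin $O$ is an isolated singular point of the system $\dot x=\mathcal X(x,y),\ \dot y=\mathcal Y(x,y)$. In polar coordinates, after dividing by $\rho^{m-1}$, the system becomes $\dot\rho=\rho\mathcal H(\rho,\theta),\ \dot\theta=\mathcal G(\rho,\theta)$ with $\mathcal H=\sum_{k\ge0}H_k(\theta)\rho^k$, $\mathcal G=\sum_{k\ge0}G_k(\theta)\rho^k$, $G_k(\theta)=Y_{k+m}(\cos\theta,\sin\theta)\cos\theta-X_{k+m}(\cos\theta,\sin\theta)\sin\theta$,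 $H_k(\theta)=X_{k+m}(\cos\theta,\sin\theta)\cos\theta+Y_{k+m}(\cos\theta,\sin\theta)\sin\theta$. It is assumed throughout that neither $\mathcal G$ nor $\mathcal H$ is identically $0$. **Newton polygons.** For a nonzero real analytic $F(\rho,\theta)=\sum a_{i,j}(F)\rho^i\theta^j$ near $(0,0)$, let $\Delta(F)=\{(i,j)\in\mathbb Z_{\ge0}^2:a_{i,j}(F)\ne0\}$ (valid indices) and let the Newton polygon $\mathcal N_F$ be the compact polygon in the boundary of $\mathrm{conv}(\Delta(F)+\mathbb R_{\ge0}^2)$ in the $(u,v)$-plane (the boundary minus its vertical and horizontal rays; possibly a single point). Its vertices, ordered by increasing abscissa, are $V_0(F),\dots,V_{s(F)}(F)$; write $V_k(\mathcal G)=(i_k,j_k)$ and $V_k(\mathcal H)=(\tilde i_k,\tilde j_k)$. $E_k(F)$ is the edge (closed segment) from $V_{k-1}(F)$ to $V_k(F)$, with slope $\zeta(E_k(F))<0$; put $\zeta(E_0(F))=-\infty$, $\zeta(E_{s(F)+1}(F))=0$, $\zeta^-(V_k(F))=\zeta(E_k(F))$, $\zeta^+(V_k(F))=\zeta(E_{k+1}(F))$. $\mathfrak S(F)$ is the set of slopes of edges of $\mathcal N_F$. For $\xi<0$ the $\xi$-component $\sigma(F,\xi)$ is $E_k(F)$ if $\xi=\zeta(E_k(F))$, and $V_k(F)$ if $\zeta^-(V_k(F))<\xi<\zeta^+(V_k(F))$. The $\xi$-componential polynomial is $\mathcal K_\xi(F)(\theta)=\sum_{(i,j)\in\sigma(F,\xi)\cap\Delta(F)}a_{i,j}(F)\theta^j$.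 **Slope sequences.** Let $\xi_1<\dots<\xi_{s(\mathcal G,\mathcal H)}$ be the elements of $\mathfrak S(\mathcal G)\cup\mathfrak S(\mathcal H)$ and $\xi_{s_1}<\dots<\xi_{s_r}$ ($r=r(\mathcal G,\mathcal H)\ge0$) those of $\mathfrak S(\mathcal G)\cap\mathfrak S(\mathcal H)$. The vertex sequence $(V_0(\mathcal G),\dots,V_{s(\mathcal G)}(\mathcal G))$ is divided into $r+1$ consecutive subsequences $\Lambda_\varrho(\mathcal G)=(V_{k_{\varrho-1}+1}(\mathcal G),\dots,V_{k_\varrho}(\mathcal G))$, $\varrho=0,\dots,r$, where $-1=k_{-1}<k_0<\dots<k_r=s(\mathcal G)$ and $\zeta^+(V_{k_\varrho}(\mathcal G))=\xi_{s_{\varrho+1}}$ for $\varrho=0,\dots,r-1$ (so $\Lambda_0(\mathcal G)$ is the whole vertex sequence if $r=0$). $\Lambda_\varrho(\mathcal H)$ is defined similarly. **Conditions.** (P1): for each $\varrho=0,\dots,r$, the ordinates of the points in $\Lambda_\varrho(\mathcal G)$ all have the same parity, those in $\Lambda_\varrho(\mathcal H)$ all have the same parity, and these two parities are different. (P2): the same for each $\varrho=0,\dots,r-1$; moreover the ordinates of the points of $\Lambda_r(\mathcal G)$ with its last element $V_{s(\mathcal G)}(\mathcal G)$ removed are all odd, and those of $\Lambda_r(\mathcal H)$ are all even. (Q): for each $k=1,\dots,s(\mathcal G,\mathcal H)$ the polynomial $[\mathcal K_{\xi_k}(\mathcal G),\mathcal K_{\xi_k}(\mathcal H)]:=(\mathcal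 K_{\xi_k}(\mathcal G))'\mathcal K_{\xi_k}(\mathcal H)-\mathcal K_{\xi_k}(\mathcal G)(\mathcal K_{\xi_k}(\mathcal H))'$ has no nonzero real roots. (S): $\mathcal N_{\mathcal G}$ (and $\mathcal N_{\mathcal H}$) contains at least two valid indices of $\mathcal G$ (of $\mathcal H$), the last two of which, in order of increasing abscissa along the polygon, are $V_*(\mathcal G)=(i_*,j_* )$ and $V_{s(\mathcal G)}(\mathcal G)=(i_{s(\mathcal G)},0)$ (respectively $V_*(\mathcal H)=(\tilde i_*,\tilde j_* )$ and $V_{s(\mathcal H)}(\mathcal H)=(\tilde i_{s(\mathcal H)},0)$), and $\{(i,j)\in\Delta(\mathcal G):0<j<j_*\}=\emptyset$ and $\{(i,j)\in\Delta(\mathcal H):0<j<\tilde j_*\}=\emptyset$. (H1): $\zeta(E_{s(\mathcal G)}(\mathcal G))>\zeta(E_{s(\mathcal H)}(\mathcal H))$ and $j_*\le\tilde j_*$. (H2): $\zeta(E_{s(\mathcal G)}(\mathcal G))>\zeta(E_{s(\mathcal H)}(\mathcal H))$, $j_*>\tilde j_*$, $\tilde j_*$ odd, and $a_{i_*,j_*}(\mathcal G)a_{\tilde i_{s(\mathcal H)},\tilde j_{s(\mathcal H)}}(\mathcal H)a_{i_{s(\mathcal G)},j_{s(\mathcal G)}}(\mathcal G)a_{\tilde i_*,\tilde j_*}(\mathcal H)<0$. (H3): $\zeta(E_{s(\mathcal G)}(\mathcal G))=\zeta(E_{s(\mathcal H)}(\mathcal H))$ and $j_*<\tilde j_*$.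 (H4): $\zeta(E_{s(\mathcal G)}(\mathcal G))=\zeta(E_{s(\mathcal H)}(\mathcal H))$, $j_*=\tilde j_*$ and $a_{i_*,j_*}(\mathcal G)a_{\tilde i_{s(\mathcal H)},\tilde j_{s(\mathcal H)}}(\mathcal H)\ne a_{i_{s(\mathcal G)},j_{s(\mathcal G)}}(\mathcal G)a_{\tilde i_*,\tilde j_*}(\mathcal H)$. **Numbers.** $\chi(\mathcal G)=\sum_{\xi\in\mathfrak S(\mathcal G)}\#\{\theta\in\mathbb R\setminus\{0\}:\mathcal K_\xi(\mathcal G)(\theta)=0\}$; $N(\mathcal G)=\chi(\mathcal G)$ if $j_{s(\mathcal G)}=0$ and $\chi(\mathcal G)+1$ if $j_{s(\mathcal G)}>0$; $N(\mathcal H)$ is defined in the same way. $\mathcal A(\mathcal G)=(a_{i_0,j_0}(\mathcal G),\dots,a_{i_{s(\mathcal G)},j_{s(\mathcal G)}}(\mathcal G))$ and $\mathcal A_j(\mathcal G)=((-1)^{j_{s(\mathcal G)}}a_{i_{s(\mathcal G)},j_{s(\mathcal G)}}(\mathcal G),\dots,(-1)^{j_0}a_{i_0,j_0}(\mathcal G))$; similarly for $\mathcal H$. $(A,B)$ denotes concatenation of finite sequences, and $\Xi(A)$ the number of sign changes in a sequence $A$ of nonzero reals. *)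

theory Defs
  imports "HOL-Analysis.Analysis" "HOL-Computational_Algebra.Polynomial"
begin

definition has_power_series :: "(real \<times> real \<Rightarrow> real) \<Rightarrow> (nat \<times> nat \<Rightarrow> real) \<Rightarrow> bool" where
  "has_power_series F a \<longleftrightarrow>
     (\<forall>\<^sub>F (x, y) in nhds (0, 0). ((\<lambda>(i, j). a (i, j) * x ^ i * y ^ j) has_sum F (x, y)) UNIV)"

definition real_analytic_at_origin :: "(real \<times> real \<Rightarrow> real) \<Rightarrow> bool" where
  "real_analytic_at_origin F \<longleftrightarrow> (\<exists>a. has_power_series F a)"

text \<open>The coefficients of a germ that is analytic at the origin are unique, so the choice below
  is a genuine definition for such germs; it is arbitrary for other functions.\<close>

definition taylor_coeff :: "(real \<times> real \<Rightarrow> real) \<Rightarrow> nat \<times> nat \<Rightarrow> real" where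
  "taylor_coeff F = (SOME a. has_power_series F a)"

definition homogeneous_part :: "(real \<times> real \<Rightarrow> real) \<Rightarrow> nat \<Rightarrow> real \<Rightarrow> real \<Rightarrow> real" where
  "homogeneous_part F k x y = (\<Sum>i\<le>k. taylor_coeff F (i, k - i) * x ^ i * y ^ (k - i))"

text \<open>Arguments: the two components of the vector field and the order \<open>m\<close> of its lowest
  homogeneous part. \<open>polar_H\<close> and \<open>polar_G\<close> are functions of the pair (radius, angle); only
  their germs at the origin matter below, where the series converge.\<close>

definition polar_G_part ::
  "(real \<times> real \<Rightarrow> real) \<Rightarrow> (real \<times> real \<Rightarrow> real) \<Rightarrow> nat \<Rightarrow> nat \<Rightarrow> real \<Rightarrow> real" where
  "polar_G_part X Y m k \<theta> =
     homogeneous_part Y (k + m) (cos \<theta>) (sin \<theta>) * cos \<theta>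
     - homogeneous_part X (k + m) (cos \<theta>) (sin \<theta>) * sin \<theta>"

definition polar_H_part ::
  "(real \<times> real \<Rightarrow> real) \<Rightarrow> (real \<times> real \<Rightarrow> real) \<Rightarrow> nat \<Rightarrow> nat \<Rightarrow> real \<Rightarrow> real" where
  "polar_H_part X Y m k \<theta> =
     homogeneous_part X (k + m) (cos \<theta>) (sin \<theta>) * cos \<theta>
     + homogeneous_part Y (k + m) (cos \<theta>) (sin \<theta>) * sin \<theta>"

definition polar_G ::
  "(real \<times> real \<Rightarrow> real) \<Rightarrow> (real \<times> real \<Rightarrow> real) \<Rightarrow> nat \<Rightarrow> real \<times> real \<Rightarrow> real" where
  "polar_G X Y m = (\<lambda>(\<rho>, \<theta>). \<Sum>k. polar_G_part X Y m k \<theta> * \<rho> ^ k)"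

definition polar_H ::
  "(real \<times> real \<Rightarrow> real) \<Rightarrow> (real \<times> real \<Rightarrow> real) \<Rightarrow> nat \<Rightarrow> real \<times> real \<Rightarrow> real" where
  "polar_H X Y m = (\<lambda>(\<rho>, \<theta>). \<Sum>k. polar_H_part X Y m k \<theta> * \<rho> ^ k)"

definition valid_indices :: "(real \<times> real \<Rightarrow> real) \<Rightarrow> (nat \<times> nat) set" where
  "valid_indices F = {p. taylor_coeff F p \<noteq> 0}"

definition pt :: "nat \<times> nat \<Rightarrow> real \<times> real" where
  "pt p = (real (fst p), real (snd p))"

definition newton_region :: "(real \<times> real \<Rightarrow> real) \<Rightarrow> (real \<times> real) set" where
  "newton_region F =
     convex hull {pt p + (x, y) | p x y. p \<in> valid_indices F \<and> 0 \<le> x \<and> 0 \<le> y}"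

text \<open>A boundary point lies on the vertical (horizontal) ray, and is not its endpoint, iff some
  point strictly below it (strictly to its left) is also on the boundary.\<close>

definition newton_polygon :: "(real \<times> real \<Rightarrow> real) \<Rightarrow> (real \<times> real) set" where
  "newton_polygon F =
     {(u, v) \<in> frontier (newton_region F).
        (\<nexists>t. t > 0 \<and> (u, v - t) \<in> frontier (newton_region F)) \<and>
        (\<nexists>t. t > 0 \<and> (u - t, v) \<in> frontier (newton_region F))}"

text \<open>The enumeration of a finite set of indices with pairwise distinct abscissae by increasing
  abscissa.\<close>

definition by_abscissa :: "(nat \<times> nat) set \<Rightarrow> (nat \<times> nat) list" where
  "by_abscissa S = (THE vs. set vs = S \<and> sorted_wrt (\<lambda>p q. fst p < fst q) vs)"

text \<open>The vertices of the polygon are the extreme points (corners) of the region. They are valid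
  indices, so nothing is lost by collecting them as pairs of natural numbers.\<close>

definition vertices :: "(real \<times> real \<Rightarrow> real) \<Rightarrow> (nat \<times> nat) list" where
  "vertices F = by_abscissa {p. pt p extreme_point_of newton_region F}"

definition last_index :: "(real \<times> real \<Rightarrow> real) \<Rightarrow> nat" where
  "last_index F = length (vertices F) - 1"

definition vertex :: "(real \<times> real \<Rightarrow> real) \<Rightarrow> nat \<Rightarrow> nat \<times> nat" where
  "vertex F k = vertices F ! k"

definition last_vertex :: "(real \<times> real \<Rightarrow> real) \<Rightarrow> nat \<times> nat" where
  "last_vertex F = vertex F (last_index F)"

definition edge :: "(real \<times> real \<Rightarrow> real) \<Rightarrow> nat \<Rightarrow> (real \<times> real) set" where
  "edge F k = closed_segment (pt (vertex F (k - 1))) (pt (vertex F k))"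

definition edge_slope :: "(real \<times> real \<Rightarrow> real) \<Rightarrow> nat \<Rightarrow> ereal" where
  "edge_slope F k =
     (if k = 0 then -\<infinity>
      else if k \<le> last_index F then
        ereal ((real (snd (vertex F k)) - real (snd (vertex F (k - 1)))) /
               (real (fst (vertex F k)) - real (fst (vertex F (k - 1)))))
      else 0)"

definition slope_before :: "(real \<times> real \<Rightarrow> real) \<Rightarrow> nat \<Rightarrow> ereal" where
  "slope_before F k = edge_slope F k"

definition slope_after :: "(real \<times> real \<Rightarrow> real) \<Rightarrow> nat \<Rightarrow> ereal" where
  "slope_after F k = edge_slope F (k + 1)"

definition slopes :: "(real \<times> real \<Rightarrow> real) \<Rightarrow> real set" where
  "slopes F = {\<xi>. \<exists>k\<in>{1..last_index F}. ereal \<xi> = edge_slope F k}"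

text \<open>For \<open>\<xi> < 0\<close> exactly one of the sets in this union is nonempty, because the slopes of the
  successive edges increase.\<close>

definition component :: "(real \<times> real \<Rightarrow> real) \<Rightarrow> real \<Rightarrow> (real \<times> real) set" where
  "component F \<xi> =
     (\<Union>k\<in>{k\<in>{1..last_index F}. ereal \<xi> = edge_slope F k}. edge F k) \<union>
     {pt (vertex F k) | k. k \<le> last_index F \<and> slope_before F k < ereal \<xi> \<and> ereal \<xi> < slope_after F k}"

definition componential_poly :: "(real \<times> real \<Rightarrow> real) \<Rightarrow> real \<Rightarrow> real poly" where
  "componential_poly F \<xi> =
     (\<Sum>p\<in>{p \<in> valid_indices F. pt p \<in> component F \<xi>}. monom (taylor_coeff F p) (snd p))"

definition common_slopes :: "(real \<times> real \<Rightarrow> real) \<Rightarrow> (real \<times> real \<Rightarrow> real) \<Rightarrow> real list" where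
  "common_slopes G H = sorted_list_of_set (slopes G \<inter> slopes H)"

text \<open>For the increasing list \<open>cs\<close> of the \<open>r\<close> common slopes, \<open>cut_index F cs \<rho>\<close> is the index
  of the last vertex of the \<open>\<rho>\<close>-th block (\<open>0 \<le> \<rho> \<le> r\<close>): the vertex at which the edge with
  the common slope number \<open>\<rho>\<close> (counted from \<open>0\<close>) begins, and the last vertex of the polygon
  if \<open>\<rho> = r\<close>.\<close>

definition cut_index :: "(real \<times> real \<Rightarrow> real) \<Rightarrow> real list \<Rightarrow> nat \<Rightarrow> nat" where
  "cut_index F cs \<rho> =
     (if \<rho> < length cs then (THE k. k \<le> last_index F \<and> slope_after F k = ereal (cs ! \<rho>))
      else last_index F)"

definition block :: "(real \<times> real \<Rightarrow> real) \<Rightarrow> real list \<Rightarrow> nat \<Rightarrow> (nat \<times> nat) list" where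
  "block F cs \<rho> =
     map (vertex F)
       [(if \<rho> = 0 then 0 else Suc (cut_index F cs (\<rho> - 1))) ..< Suc (cut_index F cs \<rho>)]"

definition opposite_parities :: "(nat \<times> nat) list \<Rightarrow> (nat \<times> nat) list \<Rightarrow> bool" where
  "opposite_parities vs ws \<longleftrightarrow>
     (\<exists>b. (\<forall>p\<in>set vs. even (snd p) \<longleftrightarrow> b) \<and> (\<forall>q\<in>set ws. even (snd q) \<longleftrightarrow> \<not> b))"

definition cond_P1 :: "(real \<times> real \<Rightarrow> real) \<Rightarrow> (real \<times> real \<Rightarrow> real) \<Rightarrow> bool" where
  "cond_P1 G H \<longleftrightarrow>
     (let cs = common_slopes G H in
       \<forall>\<rho>\<le>length cs. opposite_parities (block G cs \<rho>) (block H cs \<rho>))"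

definition cond_P2 :: "(real \<times> real \<Rightarrow> real) \<Rightarrow> (real \<times> real \<Rightarrow> real) \<Rightarrow> bool" where
  "cond_P2 G H \<longleftrightarrow>
     (let cs = common_slopes G H; r = length cs in
       (\<forall>\<rho><r. opposite_parities (block G cs \<rho>) (block H cs \<rho>)) \<and>
       (\<forall>p\<in>set (butlast (block G cs r)). odd (snd p)) \<and>
       (\<forall>q\<in>set (block H cs r). even (snd q)))"

definition bracket :: "real poly \<Rightarrow> real poly \<Rightarrow> real poly" where
  "bracket p q = pderiv p * q - p * pderiv q"

definition cond_Q :: "(real \<times> real \<Rightarrow> real) \<Rightarrow> (real \<times> real \<Rightarrow> real) \<Rightarrow> bool" where
  "cond_Q G H \<longleftrightarrow>
     (\<forall>\<xi>\<in>slopes G \<union> slopes H. \<forall>\<theta>. \<theta> \<noteq> 0 \<longrightarrow>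
        poly (bracket (componential_poly G \<xi>) (componential_poly H \<xi>)) \<theta> \<noteq> 0)"

text \<open>All valid indices on the polygon, not only its vertices.\<close>

definition polygon_indices :: "(real \<times> real \<Rightarrow> real) \<Rightarrow> (nat \<times> nat) list" where
  "polygon_indices F = by_abscissa {p \<in> valid_indices F. pt p \<in> newton_polygon F}"

definition star_vertex :: "(real \<times> real \<Rightarrow> real) \<Rightarrow> nat \<times> nat" where
  "star_vertex F = polygon_indices F ! (length (polygon_indices F) - 2)"

definition cond_S_single :: "(real \<times> real \<Rightarrow> real) \<Rightarrow> bool" where
  "cond_S_single F \<longleftrightarrow>
     length (polygon_indices F) \<ge> 2 \<and>
     last (polygon_indices F) = last_vertex F \<and> snd (last_vertex F) = 0 \<and>
     {(i, j) \<in> valid_indices F. 0 < j \<and> j < snd (star_vertex F)} = {}"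

definition cond_S :: "(real \<times> real \<Rightarrow> real) \<Rightarrow> (real \<times> real \<Rightarrow> real) \<Rightarrow> bool" where
  "cond_S G H \<longleftrightarrow> cond_S_single G \<and> cond_S_single H"

definition last_slope :: "(real \<times> real \<Rightarrow> real) \<Rightarrow> ereal" where
  "last_slope F = edge_slope F (last_index F)"

definition cond_H1 :: "(real \<times> real \<Rightarrow> real) \<Rightarrow> (real \<times> real \<Rightarrow> real) \<Rightarrow> bool" where
  "cond_H1 G H \<longleftrightarrow>
     last_slope G > last_slope H \<and> snd (star_vertex G) \<le> snd (star_vertex H)"

definition cond_H2 :: "(real \<times> real \<Rightarrow> real) \<Rightarrow> (real \<times> real \<Rightarrow> real) \<Rightarrow> bool" where
  "cond_H2 G H \<longleftrightarrow>
     last_slope G > last_slope H \<and> snd (star_vertex G) > snd (star_vertex H) \<and>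
     odd (snd (star_vertex H)) \<and>
     taylor_coeff G (star_vertex G) * taylor_coeff H (last_vertex H) *
       taylor_coeff G (last_vertex G) * taylor_coeff H (star_vertex H) < 0"

definition cond_H3 :: "(real \<times> real \<Rightarrow> real) \<Rightarrow> (real \<times> real \<Rightarrow> real) \<Rightarrow> bool" where
  "cond_H3 G H \<longleftrightarrow>
     last_slope G = last_slope H \<and> snd (star_vertex G) < snd (star_vertex H)"

definition cond_H4 :: "(real \<times> real \<Rightarrow> real) \<Rightarrow> (real \<times> real \<Rightarrow> real) \<Rightarrow> bool" where
  "cond_H4 G H \<longleftrightarrow>
     last_slope G = last_slope H \<and> snd (star_vertex G) = snd (star_vertex H) \<and>
     taylor_coeff G (star_vertex G) * taylor_coeff H (last_vertex H) \<noteq>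
       taylor_coeff G (last_vertex G) * taylor_coeff H (star_vertex H)"

definition root_count :: "(real \<times> real \<Rightarrow> real) \<Rightarrow> nat" where
  "root_count F =
     (\<Sum>\<xi>\<in>slopes F. card {\<theta>. \<theta> \<noteq> 0 \<and> poly (componential_poly F \<xi>) \<theta> = 0})"

definition number_N :: "(real \<times> real \<Rightarrow> real) \<Rightarrow> nat" where
  "number_N F = (if snd (last_vertex F) = 0 then root_count F else root_count F + 1)"

definition vertex_coeffs :: "(real \<times> real \<Rightarrow> real) \<Rightarrow> real list" where
  "vertex_coeffs F = map (taylor_coeff F) (vertices F)"

definition signed_vertex_coeffs :: "(real \<times> real \<Rightarrow> real) \<Rightarrow> real list" where
  "signed_vertex_coeffs F = rev (map (\<lambda>p. (-1) ^ snd p * taylor_coeff F p) (vertices F))"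

definition sign_changes :: "real list \<Rightarrow> nat" where
  "sign_changes xs = card {i. Suc i < length xs \<and> xs ! i * xs ! Suc i < 0}"

end

theory Submission
  imports Defs "HOL-Complex_Analysis.Complex_Analysis"
begin

text \<open>
Fix an edge of the polygon of \<open>G\<close>, with slope \<open>\<xi>\<close>. Since \<open>H\<close> has no edge of this slope, its polynomial at
\<open>\<xi>\<close> is a monomial \<open>b * \<theta> ^ j\<close>, and condition (Q) says that the derivative of the quotient
of the two polynomials has no zero on either half-axis. So the polynomial of \<open>G\<close> has at most one
positive and at most one negative root, and whether it has them is decided by its behaviour at \<open>0\<close> and at
infinity, that is, by the signs of the coefficients at the two ends of the edge: a positive root
corresponds to a sign change between \<open>a\<close> and \<open>a'\<close>, a negative one to a sign change between
\<open>(-1) ^ j * a\<close> and \<open>(-1) ^ j' * a'\<close> (\<open>card_nonzero_roots\<close>). Summing over the edges gives the sign changes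
inside the two halves of the concatenated sequence (\<open>number_N_eq_sign_changes\<close>). This needs the
combinatorics of the polygon: its vertices are valid indices, their ordinates decrease, and the slopes of
the edges increase. The same holds with \<open>G\<close> and \<open>H\<close> exchanged.

What remains is the junction of the two halves, where the sign changes exactly if the last
ordinate is odd. It must therefore be shown that a positive last ordinate is odd. If both last ordinates
were positive, no monomial of \<open>G\<close> or \<open>H\<close> would be a pure power of the radius, and the vector field would
vanish on the axis of angle \<open>0\<close>, against the isolation of the singular point. So one of them is \<open>0\<close>. In the
second case of the hypothesis both are; in the first, (P1) makes the ordinates of \<open>G\<close> and those of \<open>H\<close> have
opposite parities, so if one last ordinate is \<open>0\<close>, the other is odd.

These arguments read \<open>taylor_coeff\<close> as the coefficients of genuine convergent expansions of \<open>G\<close> and \<open>H\<close>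
that are not identically zero. The expansions exist because the angular coefficients of the polar
form extend to entire functions with geometric bounds (\<open>entire_family\<close>), to which Cauchy's inequality
and analytic continuation apply.
\<close>

section \<open>The vertices of a Newton polygon\<close>

lemma by_abscissa_enumerates:
  assumes "finite S" "inj_on fst S"
  shows "set (by_abscissa S) = S \<and> sorted_wrt (\<lambda>p q. fst p < fst q) (by_abscissa S)"
  unfolding by_abscissa_def
proof (rule theI')
  let ?vs = "map (inv_into S fst) (sorted_list_of_set (fst ` S))"
  have fst_inv: "fst (inv_into S fst n) = n" if "n \<in> fst ` S" for n
    using that by (rule f_inv_into_f)
  have "sorted_wrt (\<lambda>m n. fst (inv_into S fst m) < fst (inv_into S fst n))
    (sorted_list_of_set (fst ` S))"
    by (rule sorted_wrt_mono_rel[OF _ strict_sorted_list_of_set]) (use assms fst_inv in auto)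
  then have "sorted_wrt (\<lambda>p q. fst p < fst q) ?vs"
    by (simp add: sorted_wrt_map)
  moreover have "set ?vs = S"
    using assms by (simp add: image_image)
  moreover have "vs = ?vs" if "set vs = S" "sorted_wrt (\<lambda>p q. fst p < fst q) vs" for vs
  proof (rule map_inj_on)
    have "sorted_wrt (<) (map fst vs)"
      using that(2) by (simp add: sorted_wrt_map)
    moreover have "map fst ?vs = sorted_list_of_set (fst ` S)"
      using assms fst_inv by (subst map_map, intro map_idI) simp
    ultimately show "map fst vs = map fst ?vs"
      using that(1) assms by (intro strict_sorted_equal) auto
    show "inj_on fst (set vs \<union> set ?vs)"
      using that(1) \<open>set ?vs = S\<close> assms by simp
  qed
  ultimately show "\<exists>!vs. set vs = S \<and> sorted_wrt (\<lambda>p q. fst p < fst q) vs"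
    by metis
qed

lemma pt_inject [simp]: "pt p = pt q \<longleftrightarrow> p = q"
  by (auto simp: pt_def prod_eq_iff)

lemma convex_newton_region: "convex (newton_region F)"
  by (simp add: newton_region_def)

lemma newton_region_upward_closed:
  assumes "z \<in> newton_region F" "0 \<le> x" "0 \<le> y"
  shows "z + (x, y) \<in> newton_region F"
proof -
  define S where "S = {pt p + (x, y) | p x y. p \<in> valid_indices F \<and> 0 \<le> x \<and> 0 \<le> y}"
  have "(+) (x, y) ` S \<subseteq> S"
  proof
    fix w assume "w \<in> (+) (x, y) ` S"
    then obtain p x' y' where "p \<in> valid_indices F" "0 \<le> x'" "0 \<le> y'" "w = pt p + (x + x', y + y')"
      unfolding S_def by force
    then show "w \<in> S"
      unfolding S_def using assms(2,3) by (metis (mono_tags, lifting) add_nonneg_nonneg mem_Collect_eq)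
  qed
  then have "(+) (x, y) ` (convex hull S) \<subseteq> convex hull S"
    by (metis convex_hull_translation hull_mono)
  then show ?thesis
    using assms(1) unfolding newton_region_def S_def[symmetric] by (auto simp: add.commute)
qed

lemma valid_index_in_newton_region:
  assumes "p \<in> valid_indices F"
  shows "pt p \<in> newton_region F"
  unfolding newton_region_def
proof (rule hull_inc)
  have "pt p = pt p + (0, 0)"
    by (simp add: pt_def)
  then show "pt p \<in> {pt p + (x, y) | p x y. p \<in> valid_indices F \<and> 0 \<le> x \<and> 0 \<le> y}"
    using assms by blast
qed

text \<open>If \<open>z\<close> differed from \<open>e\<close>, then \<open>e\<close> would be the midpoint of \<open>z\<close> and of the
reflection of \<open>z\<close> in \<open>e\<close>, which the region contains because it is closed upwards. All
order properties of the vertices come from this.\<close>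

lemma extreme_point_minimal:
  assumes e: "e extreme_point_of newton_region F"
    and z: "z \<in> newton_region F" "fst z \<le> fst e" "snd z \<le> snd e"
  shows "z = e"
proof (rule ccontr)
  assume "z \<noteq> e"
  define w where "w = z + (2 * (fst e - fst z), 2 * (snd e - snd z))"
  have "w \<in> newton_region F"
    unfolding w_def using z by (intro newton_region_upward_closed) auto
  moreover have "e = midpoint z w" "z \<noteq> w"
    using \<open>z \<noteq> e\<close> by (auto simp: w_def midpoint_def prod_eq_iff)
  moreover have "midpoint z w \<in> open_segment z w"
    using \<open>z \<noteq> w\<close> by simp
  ultimately show False
    using e z(1) unfolding extreme_point_of_def by blast
qed

definition corners :: "(real \<times> real \<Rightarrow> real) \<Rightarrow> (nat \<times> nat) set" where
  "corners F = {p. pt p extreme_point_of newton_region F}"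

lemma corner_in_newton_region: "p \<in> corners F \<Longrightarrow> pt p \<in> newton_region F"
  by (simp add: corners_def extreme_point_of_def)

text \<open>An extreme point of a convex hull is one of the points whose hull is taken, here
a valid index plus a nonnegative vector; minimality makes that vector zero.\<close>

lemma corner_valid:
  assumes "p \<in> corners F"
  shows "p \<in> valid_indices F"
proof -
  have e: "pt p extreme_point_of newton_region F"
    using assms by (simp add: corners_def)
  then have "pt p \<in> {pt p + (x, y) | p x y. p \<in> valid_indices F \<and> 0 \<le> x \<and> 0 \<le> y}"
    unfolding newton_region_def by (rule extreme_point_of_convex_hull)
  then obtain q x y where q: "q \<in> valid_indices F" "0 \<le> x" "0 \<le> y" "pt p = pt q + (x, y)"
    by blast
  have "pt q = pt p"
    by (rule extreme_point_minimal[OF e valid_index_in_newton_region[OF q(1)]])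
      (use q in auto)
  then show ?thesis
    using q(1) by simp
qed

lemma corners_antichain:
  assumes "p \<in> corners F" "q \<in> corners F" "fst p \<le> fst q" "snd p \<le> snd q"
  shows "p = q"
  using extreme_point_minimal[of "pt q" F "pt p"] assms corner_in_newton_region[OF assms(1)]
  by (simp add: corners_def pt_def prod_eq_iff)

lemma inj_on_fst_corners: "inj_on fst (corners F)"
  by (rule inj_onI) (metis corners_antichain nle_le)

lemma inj_on_snd_corners: "inj_on snd (corners F)"
  by (rule inj_onI) (metis corners_antichain nle_le)

text \<open>An antichain of \<open>nat \<times> nat\<close> is finite: compared with a fixed corner, every other
one has a smaller abscissa or a smaller ordinate, and each coordinate determines the corner.\<close>

lemma finite_corners: "finite (corners F)"
proof (cases "corners F = {}")
  case False
  then obtain p where p: "p \<in> corners F"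
    by blast
  have "corners F \<subseteq> {q \<in> corners F. fst q \<in> {..fst p}} \<union> {q \<in> corners F. snd q \<in> {..snd p}}"
    using corners_antichain[OF p] nat_le_linear by fastforce
  moreover have "finite {q \<in> corners F. fst q \<in> {..fst p}}"
    using finite_vimage_IntI[OF _ inj_on_fst_corners, of "{..fst p}"]
    by (rule finite_subset[rotated]) auto
  moreover have "finite {q \<in> corners F. snd q \<in> {..snd p}}"
    using finite_vimage_IntI[OF _ inj_on_snd_corners, of "{..snd p}"]
    by (rule finite_subset[rotated]) auto
  ultimately show ?thesis
    by (meson finite_UnI finite_subset)
qed simp

text \<open>The points of the plane that are lexicographically at least \<open>p\<close>, ordinate first, form a convex
set with \<open>p\<close> as an extreme point, and this set
contains the whole region.\<close>

lemma lowest_valid_index_is_corner: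
  assumes p: "p \<in> valid_indices F"
    and min: "\<And>q. q \<in> valid_indices F \<Longrightarrow> snd p < snd q \<or> (snd p = snd q \<and> fst p \<le> fst q)"
  shows "p \<in> corners F"
proof -
  define C where "C = {z :: real \<times> real. snd p < snd z \<or> (snd z = snd p \<and> fst p \<le> fst z)}"
  have "convex C"
  proof (rule convexI)
    fix a b :: "real \<times> real" and u v :: real
    assume ab: "a \<in> C" "b \<in> C" and uv: "0 \<le> u" "0 \<le> v" "u + v = 1"
    show "u *\<^sub>R a + v *\<^sub>R b \<in> C"
    proof (cases "u = 0 \<or> v = 0")
      case True
      then show ?thesis using ab uv by auto
    next
      case False
      then have pos: "u > 0" "v > 0" using uv by auto
      have v: "v = 1 - u" using uv by simp
      have a: "snd p \<le> snd a" and b: "snd p \<le> snd b" using ab by (auto simp: C_def)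
      have split: "u * snd a + v * snd b - snd p = u * (snd a - snd p) + v * (snd b - snd p)"
        unfolding v by (simp add: algebra_simps)
      show ?thesis
      proof (cases "snd a = snd p \<and> snd b = snd p")
        case True
        then have "fst p \<le> fst a" "fst p \<le> fst b" using ab by (auto simp: C_def)
        then have "u * (fst a - fst p) + v * (fst b - fst p) \<ge> 0"
          using uv by simp
        then have "fst p \<le> u * fst a + v * fst b"
          unfolding v by (simp add: algebra_simps)
        moreover have "u * snd a + v * snd b = snd p"
          using True split by simp
        ultimately show ?thesis by (simp add: C_def)
      next
        case False
        then have "snd a - snd p > 0 \<or> snd b - snd p > 0" using a b by auto
        then have "u * (snd a - snd p) + v * (snd b - snd p) > 0"
          using pos a b by (auto intro: add_pos_nonneg add_nonneg_pos)
        then show ?thesis using split by (simp add: C_def)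
      qed
    qed
  qed
  moreover have "{pt p + (x, y) | p x y. p \<in> valid_indices F \<and> 0 \<le> x \<and> 0 \<le> y} \<subseteq> C"
    using min by (force simp: C_def pt_def)
  ultimately have sub: "newton_region F \<subseteq> C"
    unfolding newton_region_def by (rule hull_minimal[rotated])
  have "pt p \<notin> open_segment a b" if "a \<in> C" "b \<in> C" for a b
  proof
    assume "pt p \<in> open_segment a b"
    then obtain u where u: "0 < u" "u < 1" "pt p = (1 - u) *\<^sub>R a + u *\<^sub>R b" and "a \<noteq> b"
      by (auto simp: in_segment)
    then have s: "(1 - u) * (snd a - snd p) + u * (snd b - snd p) = 0"
      and f: "(1 - u) * (fst a - fst p) + u * (fst b - fst p) = 0"
      by (auto simp: pt_def prod_eq_iff algebra_simps)
    have nonneg: "snd a - snd p \<ge> 0" "snd b - snd p \<ge> 0"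
      using that by (auto simp: C_def)
    then have s0: "snd a = snd p" "snd b = snd p"
      using s u by (auto simp: add_nonneg_eq_0_iff)
    then have "fst a - fst p \<ge> 0" "fst b - fst p \<ge> 0"
      using that by (auto simp: C_def)
    then have "fst a = fst p" "fst b = fst p"
      using f u by (auto simp: add_nonneg_eq_0_iff)
    then show False using s0 \<open>a \<noteq> b\<close> by (auto simp: prod_eq_iff)
  qed
  then show ?thesis
    using sub valid_index_in_newton_region[OF p]
    unfolding corners_def extreme_point_of_def by blast
qed

lemma set_vertices: "set (vertices F) = corners F"
  and sorted_vertices: "sorted_wrt (\<lambda>p q. fst p < fst q) (vertices F)"
  using by_abscissa_enumerates[OF finite_corners inj_on_fst_corners]
  unfolding vertices_def corners_def by auto

lemma lowest_valid_index:
  assumes "valid_indices F \<noteq> {}"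
  obtains p where "p \<in> corners F" "\<And>q. q \<in> valid_indices F \<Longrightarrow> snd p \<le> snd q"
proof -
  define j where "j = (LEAST j. j \<in> snd ` valid_indices F)"
  have j: "j \<in> snd ` valid_indices F" "\<And>q. q \<in> valid_indices F \<Longrightarrow> j \<le> snd q"
    using assms unfolding j_def by (auto intro: LeastI Least_le)
  define i where "i = (LEAST i. (i, j) \<in> valid_indices F)"
  have i: "(i, j) \<in> valid_indices F" "\<And>i'. (i', j) \<in> valid_indices F \<Longrightarrow> i \<le> i'"
    using j(1) unfolding i_def by (auto intro: LeastI Least_le)
  have "(i, j) \<in> corners F"
  proof (rule lowest_valid_index_is_corner)
    fix q assume "q \<in> valid_indices F"
    then show "snd (i, j) < snd q \<or> snd (i, j) = snd q \<and> fst (i, j) \<le> fst q"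
      using i(2)[of "fst q"] j(2)[of q] by (cases "snd q = j") auto
  qed (rule i(1))
  then show ?thesis
    using that j(2) by auto
qed

lemma length_vertices:
  assumes "valid_indices F \<noteq> {}"
  shows "length (vertices F) = Suc (last_index F)"
proof -
  have "set (vertices F) \<noteq> {}"
    using lowest_valid_index[OF assms] set_vertices[of F] by (metis empty_iff)
  then show ?thesis
    by (simp add: last_index_def)
qed

lemma vertex_in_corners:
  assumes "valid_indices F \<noteq> {}" "k \<le> last_index F"
  shows "vertex F k \<in> corners F"
  using assms length_vertices[OF assms(1)] set_vertices[of F] nth_mem[of k "vertices F"]
  by (simp add: vertex_def)

lemma vertex_abscissae_increase:
  assumes "valid_indices F \<noteq> {}" "k < l" "l \<le> last_index F"
  shows "fst (vertex F k) < fst (vertex F l)"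
  using sorted_wrt_nth_less[OF sorted_vertices, of k l F] assms length_vertices[OF assms(1)]
  by (simp add: vertex_def)

lemma vertex_ordinates_decrease:
  assumes "valid_indices F \<noteq> {}" "k < l" "l \<le> last_index F"
  shows "snd (vertex F l) < snd (vertex F k)"
proof (rule ccontr)
  assume "\<not> ?thesis"
  moreover have less: "fst (vertex F k) < fst (vertex F l)"
    using assms by (rule vertex_abscissae_increase)
  moreover have "vertex F k \<in> corners F" "vertex F l \<in> corners F"
    using assms by (auto intro: vertex_in_corners)
  ultimately have "vertex F k = vertex F l"
    by (intro corners_antichain) auto
  then show False using less by simp
qed

text \<open>This is what makes the last ordinate detect divisibility by the angle: it is positive exactly
when no monomial of the series is a pure power of the radius.\<close>

lemma last_vertex_is_lowest:
  assumes "q \<in> valid_indices F"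
  shows "snd (last_vertex F) \<le> snd q"
proof -
  have ne: "valid_indices F \<noteq> {}" using assms by blast
  then obtain p where p: "p \<in> corners F" "snd p \<le> snd q"
    using lowest_valid_index assms by metis
  then obtain k where k: "k \<le> last_index F" "p = vertex F k"
    using length_vertices[OF ne] set_vertices[of F]
    by (metis in_set_conv_nth less_Suc_eq_le vertex_def)
  then have "snd (last_vertex F) \<le> snd p"
    unfolding last_vertex_def using vertex_ordinates_decrease[OF ne, of k "last_index F"]
    by (cases "k = last_index F") auto
  then show ?thesis using p by simp
qed

definition chord_slope :: "nat \<times> nat \<Rightarrow> nat \<times> nat \<Rightarrow> real" where
  "chord_slope p q = (real (snd q) - real (snd p)) / (real (fst q) - real (fst p))"

lemma edge_slope_eq:
  "1 \<le> k \<Longrightarrow> k \<le> last_index F \<Longrightarrow>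
    edge_slope F k = ereal (chord_slope (vertex F (k - 1)) (vertex F k))"
  by (simp add: edge_slope_def chord_slope_def)

text \<open>Convexity of the region. If the slopes did not increase, the chord from \<open>p\<close> to \<open>r\<close> would contain
a point \<open>z\<close> with the abscissa of \<open>q\<close> and an ordinate that is at most that of \<open>q\<close>; minimality forces
\<open>z = pt q\<close>, so \<open>q\<close> is interior to a segment of the region.\<close>

lemma chord_slopes_increase:
  assumes "p \<in> corners F" "q \<in> corners F" "r \<in> corners F" and pq: "fst p < fst q" and qr: "fst q < fst r"
  shows "chord_slope p q < chord_slope q r"
proof (rule ccontr)
  assume "\<not> ?thesis"
  define A B where "A = real (fst q) - fst p" and "B = real (fst r) - fst q"
  have AB: "A > 0" "B > 0"
    using pq qr by (auto simp: A_def B_def)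
  from \<open>\<not> ?thesis\<close> have "chord_slope q r \<le> chord_slope p q"
    by simp
  then have le: "(real (snd r) - snd q) * A \<le> (real (snd q) - snd p) * B"
    using AB unfolding chord_slope_def A_def[symmetric] B_def[symmetric]
    by (simp add: not_less pos_divide_le_eq le_divide_eq)
  define u where "u = A / (A + B)"
  have u: "0 < u" "u < 1" "1 - u = B / (A + B)"
    using AB by (auto simp: u_def field_simps)
  define z where "z = (1 - u) *\<^sub>R pt p + u *\<^sub>R pt r"
  have z: "z \<in> newton_region F"
    unfolding z_def using assms u corner_in_newton_region
    by (intro convexD[OF convex_newton_region]) auto
  have fz: "fst z = fst q"
  proof -
    have "fst z = (B * fst p + A * fst r) / (A + B)"
      unfolding z_def u(3) by (simp add: u_def pt_def add_divide_distrib)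
    also have "B * fst p + A * fst r = fst q * (A + B)"
      by (simp add: A_def B_def algebra_simps)
    finally show ?thesis using AB by simp
  qed
  have "snd z = (B * snd p + A * snd r) / (A + B)"
    unfolding z_def u(3) by (simp add: u_def pt_def add_divide_distrib)
  moreover have "B * snd p + A * snd r \<le> snd q * (A + B)"
    using le by (simp add: algebra_simps)
  ultimately have "snd z \<le> snd q"
    using AB by (simp add: pos_divide_le_eq)
  then have "z = pt q"
    using extreme_point_minimal[OF _ z, of "pt q"] assms(2) fz by (simp add: corners_def pt_def)
  moreover have "z \<in> open_segment (pt p) (pt r)"
    unfolding z_def in_segment using u pq qr by auto
  ultimately have "pt q \<in> open_segment (pt p) (pt r)"
    by simp
  moreover have "pt q extreme_point_of newton_region F"
    using assms(2) by (simp add: corners_def)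
  ultimately show False
    using corner_in_newton_region[OF assms(1)] corner_in_newton_region[OF assms(3)]
    unfolding extreme_point_of_def by blast
qed

lemma chord_slope_negative:
  assumes "p \<in> corners F" "q \<in> corners F" "fst p < fst q"
  shows "chord_slope p q < 0"
proof -
  have "snd q < snd p"
    using corners_antichain[OF assms(1,2)] assms(3) by fastforce
  then show ?thesis
    using assms(3) by (simp add: chord_slope_def divide_neg_pos)
qed

lemma edge_slopes_increase:
  assumes ne: "valid_indices F \<noteq> {}" and "k < l" "l \<le> Suc (last_index F)"
  shows "edge_slope F k < edge_slope F l"
  using assms(2,3)
proof (induction l)
  case (Suc l)
  \<comment> \<open>The conventional values \<open>-\<infinity>\<close> and \<open>0\<close> at the two ends bound the slopes of the edges.\<close>
  have step: "edge_slope F l < edge_slope F (Suc l)"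
  proof (cases "l = 0 \<or> l = last_index F")
    case True
    have "edge_slope F l < 0" if "l \<noteq> 0" "l = last_index F"
      using that edge_slope_eq[of l F]
        chord_slope_negative[OF vertex_in_corners vertex_in_corners vertex_abscissae_increase, OF ne _ ne _ ne]
      by simp
    then show ?thesis
      using True edge_slope_eq[of "Suc l" F] by (auto simp: edge_slope_def)
  next
    case False
    then show ?thesis
      using Suc.prems edge_slope_eq[of l F] edge_slope_eq[of "Suc l" F]
        chord_slopes_increase[of "vertex F (l - 1)" F "vertex F l" "vertex F (Suc l)"]
        vertex_in_corners[OF ne] vertex_abscissae_increase[OF ne]
      by simp
  qed
  show ?case
    using Suc step by (cases "k = l") auto
qed simp

lemma edge_slope_less_iff:
  assumes "valid_indices F \<noteq> {}" "k \<le> Suc (last_index F)" "l \<le> Suc (last_index F)"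
  shows "edge_slope F k < edge_slope F l \<longleftrightarrow> k < l"
  using edge_slopes_increase[OF assms(1), of k l] edge_slopes_increase[OF assms(1), of l k] assms(2,3)
  by (cases k l rule: linorder_cases) auto

lemma edge_slope_eq_iff:
  assumes "valid_indices F \<noteq> {}" "k \<le> Suc (last_index F)" "l \<le> Suc (last_index F)"
  shows "edge_slope F k = edge_slope F l \<longleftrightarrow> k = l"
  using edge_slope_less_iff[OF assms] edge_slope_less_iff[OF assms(1,3,2)]
  by (cases k l rule: linorder_cases) auto

text \<open>Edges are counted from \<open>0\<close> here, edge \<open>k\<close> being the one that starts at vertex \<open>k\<close>, so that sums over
edges range over \<open>{..<last_index F}\<close>.\<close>

definition slope_of_edge :: "(real \<times> real \<Rightarrow> real) \<Rightarrow> nat \<Rightarrow> real" where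
  "slope_of_edge F k = chord_slope (vertex F k) (vertex F (Suc k))"

lemma ereal_slope_of_edge: "k < last_index F \<Longrightarrow> ereal (slope_of_edge F k) = edge_slope F (Suc k)"
  by (simp add: edge_slope_eq slope_of_edge_def)

lemma slopes_eq: "slopes F = slope_of_edge F ` {..<last_index F}"
proof -
  have "\<xi> \<in> slopes F \<longleftrightarrow> (\<exists>k<last_index F. ereal \<xi> = edge_slope F (Suc k))" for \<xi>
  proof
    assume "\<xi> \<in> slopes F"
    then obtain l where "1 \<le> l" "l \<le> last_index F" "ereal \<xi> = edge_slope F l"
      unfolding slopes_def by auto
    then show "\<exists>k<last_index F. ereal \<xi> = edge_slope F (Suc k)"
      by (intro exI[of _ "l - 1"]) auto
  next
    assume "\<exists>k<last_index F. ereal \<xi> = edge_slope F (Suc k)"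
    then obtain k where "k < last_index F" "ereal \<xi> = edge_slope F (Suc k)"
      by blast
    then show "\<xi> \<in> slopes F"
      unfolding slopes_def by (intro CollectI bexI[of _ "Suc k"]) auto
  qed
  moreover have "(\<exists>k<last_index F. ereal \<xi> = edge_slope F (Suc k)) \<longleftrightarrow>
      (\<exists>k<last_index F. \<xi> = slope_of_edge F k)" for \<xi>
    by (intro ex_cong1 conj_cong refl) (simp flip: ereal_slope_of_edge)
  ultimately have "\<xi> \<in> slopes F \<longleftrightarrow> \<xi> \<in> slope_of_edge F ` {..<last_index F}" for \<xi>
    by (simp add: image_iff Bex_def)
  then show ?thesis
    by (rule set_eqI)
qed

lemma inj_on_slope_of_edge:
  assumes "valid_indices F \<noteq> {}"
  shows "inj_on (slope_of_edge F) {..<last_index F}"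
proof (rule inj_onI)
  fix k l assume "k \<in> {..<last_index F}" "l \<in> {..<last_index F}" "slope_of_edge F k = slope_of_edge F l"
  then show "k = l"
    using ereal_slope_of_edge[of k F] ereal_slope_of_edge[of l F]
      edge_slope_eq_iff[OF assms, of "Suc k" "Suc l"] by simp
qed

lemma slope_of_edge_negative:
  assumes "valid_indices F \<noteq> {}" "k < last_index F"
  shows "slope_of_edge F k < 0"
  unfolding slope_of_edge_def using assms
  by (intro chord_slope_negative[of _ F] vertex_in_corners vertex_abscissae_increase) auto

section \<open>Componential polynomials\<close>

lemma component_at_edge:
  assumes ne: "valid_indices F \<noteq> {}" and k: "k < last_index F"
  shows "component F (slope_of_edge F k) = closed_segment (pt (vertex F k)) (pt (vertex F (Suc k)))"
proof -
  have "{l \<in> {1..last_index F}. edge_slope F (Suc k) = edge_slope F l} = {Suc k}"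
  proof -
    have "edge_slope F (Suc k) = edge_slope F l \<longleftrightarrow> l = Suc k" if "l \<le> last_index F" for l
      using edge_slope_eq_iff[OF ne, of "Suc k" l] k that by auto
    then show ?thesis using k by auto
  qed
  moreover have "\<not> (edge_slope F l < edge_slope F (Suc k) \<and> edge_slope F (Suc k) < edge_slope F (Suc l))"
    if "l \<le> last_index F" for l
    using that k edge_slope_less_iff[OF ne, of l "Suc k"] edge_slope_less_iff[OF ne, of "Suc k" "Suc l"]
    by simp
  then have "{pt (vertex F l) | l. l \<le> last_index F \<and> edge_slope F l < edge_slope F (Suc k) \<and>
      edge_slope F (Suc k) < edge_slope F (l + 1)} = {}"
    by simp
  ultimately show ?thesis
    unfolding component_def ereal_slope_of_edge[OF k] slope_before_def slope_after_def
    by (simp only:) (simp add: edge_def)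
qed

text \<open>The slopes increase from \<open>-\<infinity>\<close> to \<open>0\<close>, so a negative number that is not a slope lies between the
slopes on the two sides of exactly one vertex.\<close>

lemma component_at_vertex:
  assumes ne: "valid_indices F \<noteq> {}" and \<xi>: "\<xi> < 0" "\<xi> \<notin> slopes F"
  obtains k where "k \<le> last_index F" "component F \<xi> = {pt (vertex F k)}"
proof -
  let ?P = "\<lambda>k. ereal \<xi> < edge_slope F k"
  have P: "?P (Suc (last_index F))" "\<not> ?P 0"
    using \<xi> by (auto simp: edge_slope_def)
  define k where "k = (LEAST k. ?P (Suc k))"
  have k: "?P (Suc k)"
    unfolding k_def by (rule LeastI) (rule P)
  have k_le: "k \<le> last_index F"
    unfolding k_def by (rule Least_le) (rule P)
  have "\<not> ?P k"
    using P(2) not_less_Least[of _ "\<lambda>k. ?P (Suc k)"] unfolding k_def[symmetric]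
    by (metis lessI not0_implies_Suc)
  moreover have no_edge: "ereal \<xi> \<noteq> edge_slope F l" if "1 \<le> l" "l \<le> last_index F" for l
    using \<xi>(2) that by (auto simp: slopes_def)
  moreover have "edge_slope F 0 \<noteq> ereal \<xi>"
    by (simp add: edge_slope_def)
  ultimately have k': "edge_slope F k < ereal \<xi>"
    using k_le by (metis One_nat_def Suc_leI linorder_neqE neq0_conv)
  have "l = k" if "l \<le> last_index F" "edge_slope F l < ereal \<xi>" "ereal \<xi> < edge_slope F (Suc l)" for l
    using edge_slope_less_iff[OF ne, of l "Suc k"] edge_slope_less_iff[OF ne, of k "Suc l"] k k' k_le that
    by (auto dest: less_trans)
  then have iff: "l \<le> last_index F \<and> edge_slope F l < ereal \<xi> \<and> ereal \<xi> < edge_slope F (l + 1) \<longleftrightarrow> l = k" for l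
    using k k' k_le by (metis Suc_eq_plus1)
  have "{pt (vertex F l) | l. l \<le> last_index F \<and> edge_slope F l < ereal \<xi> \<and>
      ereal \<xi> < edge_slope F (l + 1)} = {pt (vertex F k)}"
    unfolding iff by simp
  moreover have "{l \<in> {1..last_index F}. ereal \<xi> = edge_slope F l} = {}"
    using no_edge by auto
  ultimately have "component F \<xi> = {pt (vertex F k)}"
    unfolding component_def slope_before_def slope_after_def by (simp only: UN_empty Un_empty_left)
  with k_le show ?thesis
    by (rule that)
qed

lemma componential_poly_at_vertex:
  assumes "valid_indices F \<noteq> {}" "\<xi> < 0" "\<xi> \<notin> slopes F"
  obtains b j where "componential_poly F \<xi> = monom b j"
proof -
  obtain k where k: "k \<le> last_index F" "component F \<xi> = {pt (vertex F k)}"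
    using component_at_vertex[OF assms] .
  have "{p \<in> valid_indices F. pt p \<in> component F \<xi>} = {vertex F k}"
    using k corner_valid[OF vertex_in_corners[OF assms(1) k(1)]] by auto
  then show ?thesis
    using that by (simp add: componential_poly_def)
qed

lemma closed_segment_ordinates:
  assumes "z \<in> closed_segment (pt p) (pt q)" "snd q < snd p"
  shows "snd q \<le> snd z" "snd z \<le> snd p" "snd z = snd q \<Longrightarrow> z = pt q" "snd z = snd p \<Longrightarrow> z = pt p"
proof -
  obtain u where u: "0 \<le> u" "u \<le> 1" "z = (1 - u) *\<^sub>R pt p + u *\<^sub>R pt q"
    using assms(1) by (auto simp: in_segment)
  define d where "d = real (snd p) - real (snd q)"
  have d: "d > 0" using assms(2) by (simp add: d_def)
  have z: "snd z = snd p - u * d" "snd z = snd q + (1 - u) * d"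
    using u(3) by (auto simp: pt_def d_def algebra_simps)
  show "snd q \<le> snd z" using z(2) u d by simp
  show "snd z \<le> snd p" using z(1) u d by simp
  show "z = pt q" if "snd z = snd q"
  proof -
    have "u = 1" using that z(2) d by simp
    then show ?thesis using u(3) by simp
  qed
  show "z = pt p" if "snd z = snd p"
  proof -
    have "u = 0" using that z(1) d by simp
    then show ?thesis using u(3) by simp
  qed
qed

text \<open>The ordinate decreases strictly along the edge, so distinct valid indices on it give distinct
powers: the two end vertices supply the lowest and the leading coefficient.\<close>

lemma componential_poly_at_edge:
  assumes ne: "valid_indices F \<noteq> {}" and k: "k < last_index F"
  defines "p \<equiv> vertex F k" and "q \<equiv> vertex F (Suc k)"
  defines "K \<equiv> componential_poly F (slope_of_edge F k)"
  shows "coeff K (snd q) = taylor_coeff F q" "\<And>i. i < snd q \<Longrightarrow> coeff K i = 0"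
    "degree K = snd p" "lead_coeff K = taylor_coeff F p"
proof -
  have less: "snd q < snd p"
    unfolding p_def q_def using k by (intro vertex_ordinates_decrease[OF ne]) auto
  have valid: "p \<in> valid_indices F" "q \<in> valid_indices F"
    unfolding p_def q_def using k by (auto intro!: corner_valid vertex_in_corners[OF ne])
  define S where "S = {r \<in> valid_indices F. pt r \<in> closed_segment (pt p) (pt q)}"
  have K: "K = (\<Sum>r\<in>S. monom (taylor_coeff F r) (snd r))"
    unfolding K_def S_def p_def q_def componential_poly_def component_at_edge[OF ne k] by simp
  have S: "snd q \<le> snd r" "snd r \<le> snd p" "snd r = snd q \<Longrightarrow> r = q" "snd r = snd p \<Longrightarrow> r = p"
    if "r \<in> S" for r
    using closed_segment_ordinates[of "pt r" p q] that less by (auto simp: S_def pt_def prod_eq_iff)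
  have "inj_on snd S"
  proof (rule inj_onI)
    fix r s assume rs: "r \<in> S" "s \<in> S" "snd r = snd s"
    obtain u where u: "pt r = (1 - u) *\<^sub>R pt p + u *\<^sub>R pt q"
      using rs(1) by (auto simp: S_def in_segment)
    obtain v where v: "pt s = (1 - v) *\<^sub>R pt p + v *\<^sub>R pt q"
      using rs(2) by (auto simp: S_def in_segment)
    have "(u - v) * (real (snd p) - snd q) = 0"
      using arg_cong[OF u, of snd] arg_cong[OF v, of snd] rs(3)
      by (simp add: pt_def algebra_simps)
    then have "u = v"
      using less by simp
    then show "r = s"
      using u v by (metis pt_inject)
  qed
  moreover have "finite (snd ` S)"
    using S(2) by (auto intro: finite_subset[of _ "{..snd p}"])
  ultimately have fin: "finite S"
    by (rule finite_imageD[rotated])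
  have coeff: "coeff K i = (\<Sum>r\<in>S. if snd r = i then taylor_coeff F r else 0)" for i
    unfolding K by (simp add: coeff_sum)
  have coeff_at: "coeff K (snd r) = taylor_coeff F r" if "r \<in> S" for r
  proof -
    have "coeff K (snd r) = (\<Sum>s\<in>S. if s = r then taylor_coeff F s else 0)"
      unfolding coeff using \<open>inj_on snd S\<close> that by (intro sum.cong) (auto dest: inj_onD)
    then show ?thesis
      using fin that by simp
  qed
  have ends: "p \<in> S" "q \<in> S"
    using valid by (auto simp: S_def)
  show "coeff K (snd q) = taylor_coeff F q"
    by (rule coeff_at) (rule ends)
  show "coeff K i = 0" if "i < snd q" for i
    unfolding coeff using S(1) that by (intro sum.neutral) force
  have top: "coeff K (snd p) = taylor_coeff F p"
    by (rule coeff_at) (rule ends)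
  moreover have "coeff K i = 0" if "i > snd p" for i
    unfolding coeff using S(2) that by (intro sum.neutral) force
  ultimately show deg: "degree K = snd p"
    using valid(1) by (intro antisym degree_le le_degree) (auto simp: valid_indices_def)
  show "lead_coeff K = taylor_coeff F p"
    using top deg by simp
qed

section \<open>Real roots of a polynomial with nonvanishing bracket\<close>

lemma poly_sign_near_zero:
  fixes p :: "real poly"
  assumes "coeff p n \<noteq> 0" "\<And>i. i < n \<Longrightarrow> coeff p i = 0"
  obtains d where "d > 0" "\<And>x. 0 < x \<Longrightarrow> x < d \<Longrightarrow> poly p x * coeff p n > 0"
proof -
  define r where "r = poly_shift n p"
  have "p = monom 1 n * r"
    using assms(2) by (intro poly_eqI) (auto simp: r_def coeff_monom_mult coeff_poly_shift)
  then have p: "poly p x = x ^ n * poly r x" for x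
    by (metis mult_1 poly_monom poly_mult)
  have r0: "poly r 0 = coeff p n"
    by (simp add: r_def poly_0_coeff_0 coeff_poly_shift)
  have "((\<lambda>x. poly r x * coeff p n) \<longlongrightarrow> poly r 0 * coeff p n) (at_right 0)"
    by (intro tendsto_intros)
  moreover have "poly r 0 * coeff p n > 0"
    using assms(1) unfolding r0 by (metis not_real_square_gt_zero)
  ultimately have "\<forall>\<^sub>F x in at_right 0. poly r x * coeff p n > 0"
    by (rule order_tendstoD)
  then obtain d where d: "d > 0" "\<And>x. 0 < x \<Longrightarrow> x < d \<Longrightarrow> poly r x * coeff p n > 0"
    by (auto simp: eventually_at_right_field)
  show ?thesis
  proof (rule that[OF d(1)])
    fix x :: real assume "0 < x" "x < d"
    then show "poly p x * coeff p n > 0"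
      using d(2)[of x] by (simp add: p mult.assoc)
  qed
qed

lemma poly_sign_at_infinity:
  fixes p :: "real poly"
  assumes "p \<noteq> 0"
  obtains y where "\<And>x. x \<ge> y \<Longrightarrow> poly p x * lead_coeff p > 0"
proof -
  define q where "q = smult (lead_coeff p) p"
  have "lead_coeff q = lead_coeff p * lead_coeff p"
    by (simp add: q_def)
  moreover have "lead_coeff p * lead_coeff p > 0"
    using assms by (metis leading_coeff_0_iff not_real_square_gt_zero)
  ultimately have "lead_coeff q > 0"
    by simp
  then obtain y where "\<forall>x\<ge>y. poly q x \<ge> lead_coeff q"
    using poly_pinfty_gt_lc by blast
  then show ?thesis
    using that[of y] \<open>lead_coeff q > 0\<close> by (force simp: q_def mult.commute)
qed

text \<open>The bracket of \<open>p\<close> and \<open>q\<close> is the numerator of the derivative of \<open>p / q\<close>. For a monomial \<open>q\<close> whose bracket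
with \<open>p\<close> has no positive root, the quotient is therefore strictly monotone on the positive axis,
where \<open>q\<close> has constant sign. So \<open>p\<close> has at most one positive root, and it has one exactly when its
signs near \<open>0\<close> and near infinity differ; these are the signs of its lowest and leading
coefficients.\<close>

lemma card_positive_roots:
  fixes p :: "real poly"
  assumes low: "coeff p n \<noteq> 0" "\<And>i. i < n \<Longrightarrow> coeff p i = 0"
    and br: "\<And>x. x > 0 \<Longrightarrow> poly (bracket p (monom b j)) x \<noteq> 0"
  shows "card {x. x > 0 \<and> poly p x = 0} = of_bool (coeff p n * lead_coeff p < 0)"
proof -
  have p0: "p \<noteq> 0"
    using low(1) by auto
  define q where "q = monom b j"
  have b: "b \<noteq> 0"
    using br[of 1] by (auto simp: bracket_def)
  then have q_sign: "poly q x * poly q y > 0" if "x > 0" "y > 0" for x y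
  proof -
    have "poly q x * poly q y = b\<^sup>2 * (x ^ j * y ^ j)"
      by (simp add: q_def poly_monom power2_eq_square algebra_simps)
    then show ?thesis
      using b that by simp
  qed
  then have q0: "poly q x \<noteq> 0" if "x > 0" for x
    using q_sign[OF that that] by auto
  define f where "f = (\<lambda>x. poly p x / poly q x)"
  have f': "(f has_real_derivative poly (bracket p q) x / (poly q x)\<^sup>2) (at x)" if "x > 0" for x
    unfolding f_def using q0[OF that]
    by (auto intro!: derivative_eq_intros simp: bracket_def power2_eq_square mult.commute)
  have cont: "continuous_on {x..y} f" if "x > 0" for x y
    by (intro continuous_at_imp_continuous_on ballI DERIV_isCont[OF f']) (use that in auto)
  have inj: "f x \<noteq> f y" if "0 < x" "x < y" for x y
  proof
    assume "f x = f y"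
    moreover have "f differentiable (at u)" if "x < u" for u
      using f'[of u] that \<open>0 < x\<close> by (auto simp: real_differentiable_def)
    ultimately obtain z where "x < z" "z < y" "DERIV f z :> 0"
      using Rolle[of x y f] cont[OF \<open>0 < x\<close>] \<open>x < y\<close> by blast
    then have "poly (bracket p q) z / (poly q z)\<^sup>2 = 0"
      using DERIV_unique f'[of z] that by force
    then show False
      using br[of z] q0[of z] that \<open>x < z\<close> unfolding q_def[symmetric] by simp
  qed
  obtain d where d: "d > 0" "\<And>x. 0 < x \<Longrightarrow> x < d \<Longrightarrow> poly p x * coeff p n > 0"
    using poly_sign_near_zero[OF low] by blast
  obtain y where y: "\<And>x. x \<ge> y \<Longrightarrow> poly p x * lead_coeff p > 0"
    using poly_sign_at_infinity[OF p0] by blast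
  \<comment> \<open>Take \<open>s\<close> so small and \<open>t\<close> so large that \<open>p\<close> has there its signs near \<open>0\<close> and near infinity.\<close>
  have outer: "\<exists>s t. 0 < s \<and> s < r \<and> r < t \<and> (poly p s * poly p t < 0 \<longleftrightarrow> coeff p n * lead_coeff p < 0)"
    if "r > 0" for r
  proof -
    have "poly p (min r d / 2) * coeff p n > 0" "poly p (max y (r + 1)) * lead_coeff p > 0"
      using that d y by auto
    then have "poly p (min r d / 2) * poly p (max y (r + 1)) < 0 \<longleftrightarrow> coeff p n * lead_coeff p < 0"
      by (auto simp: zero_less_mult_iff mult_less_0_iff)
    moreover have "0 < min r d / 2" "min r d / 2 < r" "r < max y (r + 1)"
      using that d(1) by (auto simp: min_def)
    ultimately show ?thesis by blast
  qed
  have iff: "(\<exists>x>0. poly p x = 0) \<longleftrightarrow> coeff p n * lead_coeff p < 0"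
  proof
    assume "\<exists>x>0. poly p x = 0"
    then obtain r where r: "r > 0" "poly p r = 0"
      by blast
    obtain s t where st: "0 < s" "s < r" "r < t"
        "poly p s * poly p t < 0 \<longleftrightarrow> coeff p n * lead_coeff p < 0"
      using outer[OF r(1)] by blast
    have "inj_on f {s..t}"
    proof (rule linorder_inj_onI')
      fix u v assume "u \<in> {s..t}" "v \<in> {s..t}" "u < v"
      then show "f u \<noteq> f v" using inj[of u v] st(1) by simp
    qed
    then have "(f s < f r \<and> f r < f t) \<or> (f t < f r \<and> f r < f s)"
      using st(2,3) cont[OF st(1)] by (intro continuous_inj_imp_mono) auto
    moreover have "f r = 0"
      using r(2) by (simp add: f_def)
    ultimately have "f s * f t < 0"
      by (auto simp: mult_less_0_iff)
    then have "poly p s * poly p t < 0"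
      using q_sign[of s t] st(1-3) by (simp add: f_def divide_less_0_iff)
    then show "coeff p n * lead_coeff p < 0"
      using st(4) by simp
  next
    assume neg: "coeff p n * lead_coeff p < 0"
    obtain s t where st: "0 < s" "s < 1" "1 < t"
        "poly p s * poly p t < 0 \<longleftrightarrow> coeff p n * lead_coeff p < 0"
      using outer[of 1] by auto
    then show "\<exists>x>0. poly p x = 0"
      using neg poly_IVT[of s t p] by (meson less_trans)
  qed
  have uniq: "x = z" if "x > 0" "z > 0" "poly p x = 0" "poly p z = 0" for x z
    using inj[of x z] inj[of z x] that by (cases x z rule: linorder_cases) (auto simp: f_def)
  show ?thesis
  proof (cases "\<exists>x>0. poly p x = 0")
    case True
    then obtain r where "r > 0" "poly p r = 0" by blast
    then have "{x. x > 0 \<and> poly p x = 0} = {r}"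
      using uniq by auto
    then show ?thesis using True iff by simp
  next
    case False
    then have "{x. x > 0 \<and> poly p x = 0} = {}" by auto
    then show ?thesis using False iff by (simp only: card.empty) simp
  qed
qed

text \<open>The negative roots of \<open>p\<close> are the positive roots of \<open>p (- x)\<close>, whose coefficients carry the
additional signs \<open>(-1) ^ i\<close>; the substitution changes the bracket only by a sign.\<close>

lemma card_nonzero_roots:
  fixes p :: "real poly"
  assumes low: "coeff p n \<noteq> 0" "\<And>i. i < n \<Longrightarrow> coeff p i = 0"
    and br: "\<And>x. x \<noteq> 0 \<Longrightarrow> poly (bracket p (monom b j)) x \<noteq> 0"
  shows "card {x. x \<noteq> 0 \<and> poly p x = 0} =
    of_bool (coeff p n * lead_coeff p < 0) +
    of_bool (((-1) ^ n * coeff p n) * ((-1) ^ degree p * lead_coeff p) < 0)"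
proof -
  define P where "P = {x. x > 0 \<and> poly p x = 0}"
  define N where "N = {x. x > 0 \<and> poly p (- x) = 0}"
  define l :: "real poly" where "l = [:0, -1:]"
  define p' where "p' = pcompose p l"
  have p0: "p \<noteq> 0"
    using low(1) by auto
  have coeff': "coeff p' i = (-1) ^ i * coeff p i" for i
    by (simp add: p'_def l_def coeff_pcompose_linear)
  have poly': "poly p' x = poly p (- x)" for x
    by (simp add: p'_def l_def poly_pcompose)
  have deg': "degree p' = degree p"
    by (simp add: p'_def l_def degree_pcompose)
  have monom': "pcompose (monom b j) l = monom ((-1) ^ j * b) j"
    by (rule poly_eqI) (simp add: l_def coeff_pcompose_linear)
  have "bracket p' (pcompose (monom b j) l) = pcompose (bracket p (monom b j)) l * [:-1:]"
    unfolding p'_def bracket_def pderiv_pcompose by (simp add: l_def pcompose_diff pcompose_mult pderiv_pCons algebra_simps)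
  then have br': "poly (bracket p' (monom ((-1) ^ j * b) j)) x = - poly (bracket p (monom b j)) (- x)" for x
    unfolding monom' by (simp add: poly_pcompose l_def)
  have "card P = of_bool (coeff p n * lead_coeff p < 0)"
    unfolding P_def by (rule card_positive_roots[OF low, of b j]) (use br in simp_all)
  moreover have "card N = of_bool (coeff p' n * lead_coeff p' < 0)"
    unfolding N_def poly'[symmetric]
    by (rule card_positive_roots[of _ _ "(- 1) ^ j * b" j]) (use low br coeff' br' in simp_all)
  moreover have "{x. x \<noteq> 0 \<and> poly p x = 0} = P \<union> uminus ` N"
  proof (intro set_eqI iffI)
    fix x assume "x \<in> {x. x \<noteq> 0 \<and> poly p x = 0}"
    then have "x \<in> P \<or> - x \<in> N"
      by (auto simp: P_def N_def)
    then show "x \<in> P \<union> uminus ` N"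
      using imageI[of "- x" N uminus] by auto
  qed (auto simp: P_def N_def)
  moreover have "card (P \<union> uminus ` N) = card P + card (uminus ` N)"
  proof (rule card_Un_disjoint)
    have "finite {x. poly p x = 0}"
      using p0 by (rule poly_roots_finite)
    moreover have "P \<subseteq> {x. poly p x = 0}" "uminus ` N \<subseteq> {x. poly p x = 0}"
      by (auto simp: P_def N_def)
    ultimately show "finite P" "finite (uminus ` N)"
      by (auto intro: finite_subset)
    show "P \<inter> uminus ` N = {}"
      by (auto simp: P_def N_def)
  qed
  moreover have "card (uminus ` N) = card N"
    by (intro card_image) simp
  ultimately show ?thesis
    by (simp add: coeff' deg')
qed

section \<open>Sign changes of concatenated sequences\<close>

lemma sign_changes_eq_sum:
  "sign_changes xs = (\<Sum>i<length xs - 1. of_bool (xs ! i * xs ! Suc i < 0))"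
proof -
  have "{i. Suc i < length xs \<and> xs ! i * xs ! Suc i < 0} =
      {..<length xs - 1} \<inter> {i. xs ! i * xs ! Suc i < 0}"
    by auto
  then show ?thesis
    by (simp add: sign_changes_def)
qed

lemma sign_changes_short [simp]: "sign_changes [] = 0" "sign_changes [x] = 0"
  by (simp_all add: sign_changes_eq_sum)

lemma sign_changes_Cons_Cons [simp]:
  "sign_changes (x # y # zs) = of_bool (x * y < 0) + sign_changes (y # zs)"
  by (simp add: sign_changes_eq_sum sum.lessThan_Suc_shift del: sum.lessThan_Suc)

lemma sign_changes_append:
  assumes "xs \<noteq> []" "ys \<noteq> []"
  shows "sign_changes (xs @ ys) = sign_changes xs + of_bool (last xs * hd ys < 0) + sign_changes ys"
  using assms
proof (induction xs)
  case (Cons x xs)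
  then show ?case
    by (cases xs; cases ys) auto
qed simp

lemma sign_changes_rev: "sign_changes (rev xs) = sign_changes xs"
proof (induction xs)
  case (Cons x xs)
  then show ?case
    using sign_changes_append[of "rev xs" "[x]"]
    by (cases xs) (simp_all add: last_rev mult.commute)
qed simp

section \<open>Families of entire functions with geometric bounds\<close>

lemma norm_sin_le_exp:
  fixes z :: complex
  shows "norm (sin z) \<le> exp (norm z)"
proof -
  have "exp (- Im z) + exp (Im z) \<le> exp (norm z) + exp (norm z)"
    using abs_Im_le_cmod[of z] by (intro add_mono) auto
  moreover have "norm (sin z) \<le> (exp (- Im z) + exp (Im z)) / 2"
    by (simp add: sin_exp_eq norm_divide norm_mult order_trans[OF norm_triangle_ineq4])
  ultimately show ?thesis
    by simp
qed

lemma eventually_nhds_origin_box: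
  assumes "\<forall>\<^sub>F z in nhds (0 :: real, 0 :: real). P z"
  shows "\<exists>e>0. \<forall>x y. \<bar>x\<bar> < e \<longrightarrow> \<bar>y\<bar> < e \<longrightarrow> P (x, y)"
proof -
  obtain d where d: "d > 0" "\<And>z. dist z (0, 0) < d \<Longrightarrow> P z"
    using assms by (auto simp: eventually_nhds_metric)
  have "P (x, y)" if "\<bar>x\<bar> < d / 2" "\<bar>y\<bar> < d / 2" for x y
  proof (rule d(2))
    have "dist (x, y) (0, 0) \<le> \<bar>x\<bar> + \<bar>y\<bar>"
      using norm_Pair_le[of x y] by (simp add: dist_norm)
    then show "dist (x, y) (0, 0) < d"
      using that by simp
  qed
  then show ?thesis
    using d(1) by (intro exI[of _ "d / 2"]) simp
qed

text \<open>The coefficients of the powers of the radius in the polar form are trigonometric polynomials in the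
angle. Extending them to the complex plane replaces the estimates for products of series in
two variables by Cauchy's inequality on the unit disc: a geometric bound there on the functions
bounds all their Taylor coefficients by the same geometric sequence, which yields an absolutely
convergent double series.\<close>

locale entire_family =
  fixes g :: "nat \<Rightarrow> complex \<Rightarrow> complex" and \<gamma> :: "nat \<Rightarrow> real \<Rightarrow> real" and A B :: real
  assumes holomorphic: "g k holomorphic_on UNIV"
    and real_on_reals: "g k (of_real t) = of_real (\<gamma> k t)"
    and geometric_bound: "norm z \<le> 1 \<Longrightarrow> norm (g k z) \<le> A * B ^ k"
    and B_pos: "B > 0"
begin

definition taylor :: "nat \<times> nat \<Rightarrow> real" where
  "taylor = (\<lambda>(k, j). Re ((deriv ^^ j) (g k) 0 / fact j))"

lemma A_nonneg: "A \<ge> 0"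
  using order_trans[OF norm_ge_zero geometric_bound[of 0 0]] by simp

lemma holomorphic_on_any: "g k holomorphic_on S"
  using holomorphic holomorphic_on_subset by blast

lemma taylor_bound: "\<bar>taylor (k, j)\<bar> \<le> A * B ^ k"
proof -
  have "norm ((deriv ^^ j) (g k) 0) \<le> fact j * (A * B ^ k) / 1 ^ j"
    by (rule Cauchy_inequality)
      (auto intro: holomorphic_on_any holomorphic_on_imp_continuous_on geometric_bound)
  then have "norm ((deriv ^^ j) (g k) 0 / fact j) \<le> A * B ^ k"
    by (simp add: norm_divide divide_le_eq mult.commute)
  then show ?thesis
    unfolding taylor_def using abs_Re_le_cmod order_trans by auto
qed

lemma taylor_sums: "(\<lambda>j. taylor (k, j) * t ^ j) sums \<gamma> k t"
proof -
  have "(\<lambda>j. (deriv ^^ j) (g k) 0 / fact j * (of_real t - 0) ^ j) sums g k (of_real t)"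
    by (rule holomorphic_power_series[of _ _ "\<bar>t\<bar> + 1"]) (auto intro: holomorphic_on_any)
  then have "(\<lambda>j. Re ((deriv ^^ j) (g k) 0 / fact j * of_real t ^ j)) sums Re (g k (of_real t))"
    by (intro sums_Re) simp
  moreover have "Re ((deriv ^^ j) (g k) 0 / fact j * of_real t ^ j) = taylor (k, j) * t ^ j" for j
    unfolding of_real_power[symmetric] 
    by (simp del: of_real_power times_divide_eq_left add: taylor_def)
  ultimately show ?thesis
    by (simp add: real_on_reals)
qed

lemma value_bound: "\<bar>t\<bar> \<le> 1 \<Longrightarrow> \<bar>\<gamma> k t\<bar> \<le> A * B ^ k"
  using geometric_bound[of "of_real t" k] by (simp add: real_on_reals)

lemma radial_summable:
  assumes "\<bar>t\<bar> \<le> 1" "\<bar>r\<bar> < 1 / B"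
  shows "summable (\<lambda>k. norm (\<gamma> k t * r ^ k))"
proof (rule summable_comparison_test')
  have "norm (B * \<bar>r\<bar>) < 1"
    using assms(2) B_pos by (simp add: field_simps abs_mult)
  then show "summable (\<lambda>k. A * (B * \<bar>r\<bar>) ^ k)"
    by (intro summable_mult summable_geometric)
  show "norm (norm (\<gamma> k t * r ^ k)) \<le> A * (B * \<bar>r\<bar>) ^ k" for k
    using mult_right_mono[OF value_bound[OF assms(1), of k], of "\<bar>r\<bar> ^ k"]
    by (simp add: abs_mult power_abs power_mult_distrib mult_ac)
qed

lemma radial_sums:
  assumes "\<bar>t\<bar> \<le> 1" "\<bar>r\<bar> < 1 / B"
  shows "(\<lambda>k. \<gamma> k t * r ^ k) sums (\<Sum>k. \<gamma> k t * r ^ k)"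
  by (rule summable_sums[OF summable_norm_cancel[OF radial_summable[OF assms]]])

text \<open>Dominated by the product of two geometric series, the double series may be summed over the
powers of \<open>t\<close> first.\<close>

lemma double_series:
  assumes "\<bar>t\<bar> < 1" "\<bar>r\<bar> < 1 / B"
  shows "((\<lambda>(k, j). taylor (k, j) * r ^ k * t ^ j) has_sum (\<Sum>k. \<gamma> k t * r ^ k)) UNIV"
proof -
  have bound: "norm (taylor (k, j) * r ^ k * t ^ j) \<le> A * (B * \<bar>r\<bar>) ^ k * \<bar>t\<bar> ^ j" for k j
  proof -
    have "\<bar>taylor (k, j)\<bar> * (\<bar>r\<bar> ^ k * \<bar>t\<bar> ^ j) \<le> A * B ^ k * (\<bar>r\<bar> ^ k * \<bar>t\<bar> ^ j)"
      by (intro mult_right_mono taylor_bound) auto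
    then show ?thesis
      by (simp add: abs_mult power_abs power_mult_distrib mult_ac)
  qed
  have geometric: "((\<lambda>n. x ^ n) has_sum 1 / (1 - x)) UNIV" if "0 \<le> x" "x < 1" for x :: real
    using that by (intro norm_summable_imp_has_sum geometric_sums) (auto simp: norm_power intro: summable_geometric)
  have q: "0 \<le> B * \<bar>r\<bar>" "B * \<bar>r\<bar> < 1"
    using assms(2) B_pos by (auto simp: field_simps)
  have "(\<lambda>(k, j). A * (B * \<bar>r\<bar>) ^ k * \<bar>t\<bar> ^ j) summable_on Sigma UNIV (\<lambda>_. UNIV)"
  proof (rule summable_on_SigmaI)
    show "((\<lambda>j. case (k, j) of (k, j) \<Rightarrow> A * (B * \<bar>r\<bar>) ^ k * \<bar>t\<bar> ^ j) has_sum
        A * (B * \<bar>r\<bar>) ^ k * (1 / (1 - \<bar>t\<bar>))) UNIV" for k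
      using has_sum_cmult_right[OF geometric[of "\<bar>t\<bar>"]] assms(1) by simp
    show "(\<lambda>k. A * (B * \<bar>r\<bar>) ^ k * (1 / (1 - \<bar>t\<bar>))) summable_on UNIV"
      using geometric[OF q] by (intro summable_on_cmult_left summable_on_cmult_right) (auto simp: summable_on_def)
  qed (use A_nonneg B_pos in auto)
  then have "(\<lambda>p. norm ((\<lambda>(k, j). taylor (k, j) * r ^ k * t ^ j) p)) summable_on Sigma UNIV (\<lambda>_. UNIV)"
    by (rule Infinite_Sum.abs_summable_on_comparison_test') (use bound in auto)
  then have summable: "(\<lambda>(k, j). taylor (k, j) * r ^ k * t ^ j) summable_on Sigma UNIV (\<lambda>_. UNIV)"
    by (rule abs_summable_summable)
  have "((\<lambda>(k, j). taylor (k, j) * r ^ k * t ^ j) has_sum (\<Sum>k. \<gamma> k t * r ^ k)) (Sigma UNIV (\<lambda>_. UNIV))"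
  proof (rule has_sum_SigmaI[OF _ _ summable])
    show "((\<lambda>j. case (k, j) of (k, j) \<Rightarrow> taylor (k, j) * r ^ k * t ^ j) has_sum \<gamma> k t * r ^ k) UNIV" for k
    proof (rule norm_summable_imp_has_sum)
      show "(\<lambda>j. case (k, j) of (k, j) \<Rightarrow> taylor (k, j) * r ^ k * t ^ j) sums (\<gamma> k t * r ^ k)"
        using sums_mult[OF taylor_sums, of "r ^ k" k t] by (simp add: mult_ac)
      have "summable (\<lambda>j. A * (B * \<bar>r\<bar>) ^ k * \<bar>t\<bar> ^ j)"
        using assms(1) by (intro summable_mult summable_geometric) simp
      then show "summable (\<lambda>j. norm (case (k, j) of (k, j) \<Rightarrow> taylor (k, j) * r ^ k * t ^ j))"
        by (rule summable_comparison_test') (use bound in auto)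
    qed
    show "((\<lambda>k. \<gamma> k t * r ^ k) has_sum (\<Sum>k. \<gamma> k t * r ^ k)) UNIV"
      using assms by (intro norm_summable_imp_has_sum radial_summable radial_sums) auto
  qed
  then show ?thesis
    by simp
qed

lemma has_power_series: "has_power_series (\<lambda>(r, t). \<Sum>k. \<gamma> k t * r ^ k) taylor"
proof -
  have "open {z :: real \<times> real. \<bar>snd z\<bar> < 1 \<and> \<bar>fst z\<bar> < 1 / B}"
    by (intro open_Collect_conj open_Collect_less continuous_intros)
  then have "\<forall>\<^sub>F z in nhds (0 :: real, 0 :: real). z \<in> {z. \<bar>snd z\<bar> < 1 \<and> \<bar>fst z\<bar> < 1 / B}"
    by (rule eventually_nhds_in_open) (use B_pos in simp)
  then show ?thesis
    unfolding has_power_series_def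
    by (rule eventually_mono) (auto intro!: double_series)
qed

text \<open>For each small angle the coefficients of a power series in the radius vanish, so every function of
the family vanishes on a real interval and, by analytic continuation, everywhere.\<close>

lemma vanishes_if_sum_vanishes:
  assumes "\<forall>\<^sub>F (r, t) in nhds (0, 0). (\<Sum>k. \<gamma> k t * r ^ k) = 0"
  shows "\<gamma> k t = 0"
proof -
  have "\<exists>d>0. \<forall>r t. \<bar>r\<bar> < d \<longrightarrow> \<bar>t\<bar> < d \<longrightarrow> (\<Sum>k. \<gamma> k t * r ^ k) = 0"
    using eventually_nhds_origin_box[OF assms] by (simp only: prod.case)
  then obtain d where d: "d > 0"
    "\<forall>r t. \<bar>r\<bar> < d \<longrightarrow> \<bar>t\<bar> < d \<longrightarrow> (\<Sum>k. \<gamma> k t * r ^ k) = 0"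
    by (elim exE conjE) (rule that)
  define e where "e = min d (min 1 (1 / B))"
  have e: "e > 0" "e \<le> 1" "e \<le> 1 / B"
    using d(1) B_pos by (auto simp: e_def)
  have zero: "(\<lambda>k. \<gamma> k t * r ^ k) sums 0" if "\<bar>t\<bar> < e" "\<bar>r\<bar> < e" for r t
    using radial_sums[of t r] d(2)[rule_format, of r t] that by (simp add: e_def)
  have small: "\<gamma> k t = 0" if t: "\<bar>t\<bar> < e" for k t
  proof (rule ccontr)
    assume "\<gamma> k t \<noteq> 0"
    moreover have "\<gamma> 0 t = 0"
      using sums_unique2[OF zero[of t 0, OF t] powser_sums_zero[of "\<lambda>k. \<gamma> k t"]] e(1) by simp
    ultimately have "k > 0"
      by (metis gr0I)
    obtain s where "0 < s" "\<And>z :: real. z \<in> cball 0 s - {0} \<Longrightarrow> (0 :: real) \<noteq> 0"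
      by (rule powser_0_nonzero[of e 0 "\<lambda>k. \<gamma> k t" "\<lambda>_. 0" k])
        (use e zero t \<open>\<gamma> k t \<noteq> 0\<close> \<open>k > 0\<close> in auto)
    from this(2)[of s] this(1) show False
      by simp
  qed
  have "(0 :: complex) islimpt of_real ` {0<..<e}"
    unfolding islimpt_approachable
  proof (intro allI impI)
    fix \<epsilon> :: real assume "\<epsilon> > 0"
    then show "\<exists>x'\<in>of_real ` {0<..<e}. x' \<noteq> (0 :: complex) \<and> dist x' 0 < \<epsilon>"
      using e(1) by (intro bexI[of _ "of_real (min \<epsilon> e / 2)"] imageI) (auto simp: min_def)
  qed
  then have "g k (of_real t) = 0"
  proof (rule analytic_continuation[OF holomorphic open_UNIV connected_UNIV subset_UNIV UNIV_I _ _ UNIV_I])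
    show "g k z = 0" if "z \<in> of_real ` {0<..<e}" for z
      using that small by (auto simp: real_on_reals)
  qed
  then show ?thesis
    by (simp add: real_on_reals)
qed

lemma analytic: "real_analytic_at_origin (\<lambda>(r, t). \<Sum>k. \<gamma> k t * r ^ k)"
  unfolding real_analytic_at_origin_def by (rule exI) (rule has_power_series)

end

section \<open>The polar form of an analytic vector field\<close>

lemma has_power_series_taylor_coeff:
  "real_analytic_at_origin F \<Longrightarrow> has_power_series F (taylor_coeff F)"
  unfolding real_analytic_at_origin_def taylor_coeff_def by (rule someI_ex[of "has_power_series F"])

text \<open>The terms of the series at a point \<open>(\<delta>, \<delta>)\<close> are bounded by the sum of their absolute values.\<close>

lemma taylor_coeff_growth:
  assumes "real_analytic_at_origin F"
  obtains M \<delta> where "M > 0" "\<delta> > 0" "\<And>i j. \<bar>taylor_coeff F (i, j)\<bar> \<le> M / \<delta> ^ (i + j)"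
proof -
  let ?a = "taylor_coeff F"
  have "\<exists>d>0. \<forall>x y. \<bar>x\<bar> < d \<longrightarrow> \<bar>y\<bar> < d \<longrightarrow>
      ((\<lambda>(i, j). ?a (i, j) * x ^ i * y ^ j) has_sum F (x, y)) UNIV"
    using eventually_nhds_origin_box[OF has_power_series_taylor_coeff[OF assms, unfolded has_power_series_def]]
    by (simp only: prod.case)
  then obtain d where d: "d > 0" "\<forall>x y. \<bar>x\<bar> < d \<longrightarrow> \<bar>y\<bar> < d \<longrightarrow>
      ((\<lambda>(i, j). ?a (i, j) * x ^ i * y ^ j) has_sum F (x, y)) UNIV"
    by (elim exE conjE) (rule that)
  define \<delta> where "\<delta> = d / 2"
  have \<delta>: "\<delta> > 0" "\<bar>\<delta>\<bar> < d"
    using d(1) by (simp_all add: \<delta>_def)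
  have "((\<lambda>(i, j). ?a (i, j) * \<delta> ^ i * \<delta> ^ j) has_sum F (\<delta>, \<delta>)) UNIV"
    using d(2)[rule_format, OF \<delta>(2) \<delta>(2)] .
  then have "(\<lambda>(i, j). ?a (i, j) * \<delta> ^ i * \<delta> ^ j) summable_on UNIV"
    by (rule has_sum_imp_summable)
  then have summable: "(\<lambda>p. norm ((\<lambda>(i, j). ?a (i, j) * \<delta> ^ i * \<delta> ^ j) p)) summable_on UNIV"
    by (rule summable_on_iff_abs_summable_on_real[THEN iffD1])
  \<comment> \<open>The summand 1 makes the bound positive.\<close>
  define M where "M = (\<Sum>\<^sub>\<infinity>p. norm ((\<lambda>(i, j). ?a (i, j) * \<delta> ^ i * \<delta> ^ j) p)) + 1"
  have le: "\<bar>?a (i, j)\<bar> * \<delta> ^ (i + j) \<le> M" for i j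
  proof -
    have "sum (\<lambda>p. norm ((\<lambda>(i, j). ?a (i, j) * \<delta> ^ i * \<delta> ^ j) p)) {(i, j)} \<le> M - 1"
      unfolding M_def using finite_sum_le_infsum[OF summable, of "{(i, j)}"] by simp
    then show ?thesis
      using \<delta> by (simp add: abs_mult power_add mult.assoc)
  qed
  have "M > 0"
    unfolding M_def by (intro add_nonneg_pos infsum_nonneg) auto
  moreover have "\<bar>?a (i, j)\<bar> \<le> M / \<delta> ^ (i + j)" for i j
    using le[of i j] \<delta> by (simp add: pos_le_divide_eq)
  ultimately show ?thesis
    using that \<delta> by blast
qed

text \<open>Both polar parts have this shape on the real axis: for the radial part \<open>c\<close> and \<open>d\<close> are the Taylor
coefficients of \<open>X\<close> and \<open>Y\<close>, for the angular part they are those of \<open>Y\<close> and the negatives of those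
of \<open>X\<close>.\<close>

definition trig_form :: "(nat \<times> nat \<Rightarrow> real) \<Rightarrow> (nat \<times> nat \<Rightarrow> real) \<Rightarrow> nat \<Rightarrow> complex \<Rightarrow> complex" where
  "trig_form c d n z =
     (\<Sum>i\<le>n. (of_real (c (i, n - i)) * cos z + of_real (d (i, n - i)) * sin z) * (cos z ^ i * sin z ^ (n - i)))"

text \<open>On the closed unit disc sine and cosine are bounded by \<open>R = exp 1\<close>, so each of the \<open>n + 1 \<le> 2 ^ n\<close>
terms of the form of degree \<open>n\<close> is at most \<open>2 * M * R * (R / \<delta>) ^ n\<close>.\<close>

lemma entire_family_trig_form:
  assumes M: "M > 0" and \<delta>: "\<delta> > 0"
    and c: "\<And>i j. \<bar>c (i, j)\<bar> \<le> M / \<delta> ^ (i + j)" and d: "\<And>i j. \<bar>d (i, j)\<bar> \<le> M / \<delta> ^ (i + j)"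
    and real: "\<And>k t. trig_form c d (k + m) (of_real t) = of_real (\<gamma> k t)"
  shows "\<exists>A B. entire_family (\<lambda>k. trig_form c d (k + m)) \<gamma> A B"
proof -
  define R :: real where "R = exp 1"
  have R: "R \<ge> 1" "R > 0"
    by (auto simp: R_def)
  have trig: "norm (cos z) \<le> R" "norm (sin z) \<le> R" if "norm z \<le> 1" for z :: complex
    using norm_cos_le[of z] norm_sin_le_exp[of z] that unfolding R_def
    by (meson exp_le_cancel_iff order_trans)+
  have bound: "norm (trig_form c d n z) \<le> 2 * M * R * (2 * R / \<delta>) ^ n" if z: "norm z \<le> 1" for n z
  proof -
    have "norm ((of_real (c (i, n - i)) * cos z + of_real (d (i, n - i)) * sin z) * (cos z ^ i * sin z ^ (n - i)))
        \<le> (2 * (M / \<delta> ^ n) * R) * R ^ n" if "i \<le> n" for i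
    proof -
      have "\<bar>c (i, n - i)\<bar> * norm (cos z) \<le> (M / \<delta> ^ n) * R" "\<bar>d (i, n - i)\<bar> * norm (sin z) \<le> (M / \<delta> ^ n) * R"
        using c[of i "n - i"] d[of i "n - i"] trig[OF z] that M \<delta> by (auto intro!: mult_mono simp del: times_divide_eq_left)
      then have "norm (of_real (c (i, n - i)) * cos z + of_real (d (i, n - i)) * sin z)
          \<le> (M / \<delta> ^ n) * R + (M / \<delta> ^ n) * R"
        by (intro norm_triangle_le add_mono) (simp_all add: norm_mult)
      moreover have "norm (cos z ^ i * sin z ^ (n - i)) \<le> R ^ i * R ^ (n - i)"
        unfolding norm_mult norm_power using trig[OF z] R by (intro mult_mono power_mono) auto
      ultimately show ?thesis
        using that M \<delta> R unfolding norm_mult[of "_ + _"]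
        by (intro mult_mono) (auto simp flip: power_add)
    qed
    then have "norm (trig_form c d n z) \<le> (\<Sum>i\<le>n. (2 * (M / \<delta> ^ n) * R) * R ^ n)"
      unfolding trig_form_def by (intro sum_norm_le) auto
    also have "\<dots> = of_nat (Suc n) * ((2 * (M / \<delta> ^ n) * R) * R ^ n)"
      by simp
    also have "\<dots> \<le> 2 ^ n * ((2 * (M / \<delta> ^ n) * R) * R ^ n)"
    proof (rule mult_right_mono)
      have "Suc n \<le> 2 ^ n"
        by (induction n) auto
      then show "real (Suc n) \<le> 2 ^ n"
        by (metis of_nat_le_iff of_nat_numeral of_nat_power)
    qed (use M \<delta> R in auto)
    also have "\<dots> = 2 * M * R * (2 * R / \<delta>) ^ n"
      by (simp add: power_mult_distrib power_divide)
    finally show ?thesis .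
  qed
  have "entire_family (\<lambda>k. trig_form c d (k + m)) \<gamma> (2 * M * R * (2 * R / \<delta>) ^ m) (2 * R / \<delta>)"
  proof
    show "trig_form c d (k + m) holomorphic_on UNIV" for k
      unfolding trig_form_def by (intro holomorphic_intros)
    show "norm (trig_form c d (k + m) z) \<le> 2 * M * R * (2 * R / \<delta>) ^ m * (2 * R / \<delta>) ^ k"
      if "norm z \<le> 1" for k z
      using bound[OF that, of "k + m"] by (simp add: power_add mult_ac)
  qed (use real R \<delta> in auto)
  then show ?thesis
    by blast
qed

lemma common_taylor_coeff_growth:
  assumes "real_analytic_at_origin X" "real_analytic_at_origin Y"
  obtains M \<delta> where "M > 0" "\<delta> > 0"
    "\<And>i j. \<bar>taylor_coeff X (i, j)\<bar> \<le> M / \<delta> ^ (i + j)" "\<And>i j. \<bar>taylor_coeff Y (i, j)\<bar> \<le> M / \<delta> ^ (i + j)"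
proof -
  obtain M1 d1 where 1: "M1 > 0" "d1 > 0" "\<And>i j. \<bar>taylor_coeff X (i, j)\<bar> \<le> M1 / d1 ^ (i + j)"
    using taylor_coeff_growth[OF assms(1)] by blast
  obtain M2 d2 where 2: "M2 > 0" "d2 > 0" "\<And>i j. \<bar>taylor_coeff Y (i, j)\<bar> \<le> M2 / d2 ^ (i + j)"
    using taylor_coeff_growth[OF assms(2)] by blast
  have "M1 / d1 ^ n \<le> max M1 M2 / min d1 d2 ^ n" "M2 / d2 ^ n \<le> max M1 M2 / min d1 d2 ^ n" for n
    using 1 2 by (auto intro!: frac_le power_mono)
  then show ?thesis
    using that[of "max M1 M2" "min d1 d2"] 1 2 by (meson less_max_iff_disj min_less_iff_conj order_trans)
qed

lemma entire_family_polar_H: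
  assumes "real_analytic_at_origin X" "real_analytic_at_origin Y"
  shows "\<exists>g A B. entire_family g (polar_H_part X Y m) A B"
proof -
  obtain M \<delta> where M: "M > 0" "\<delta> > 0"
    "\<And>i j. \<bar>taylor_coeff X (i, j)\<bar> \<le> M / \<delta> ^ (i + j)" "\<And>i j. \<bar>taylor_coeff Y (i, j)\<bar> \<le> M / \<delta> ^ (i + j)"
    using common_taylor_coeff_growth[OF assms] by blast
  have "trig_form (taylor_coeff X) (taylor_coeff Y) (k + m) (of_real t) = of_real (polar_H_part X Y m k t)" for k t
    by (simp add: trig_form_def polar_H_part_def homogeneous_part_def cos_of_real sin_of_real
        sum_distrib_left sum_distrib_right distrib_left sum.distrib mult_ac)
  from entire_family_trig_form[OF M this] show ?thesis
    by blast
qed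

lemma entire_family_polar_G:
  assumes "real_analytic_at_origin X" "real_analytic_at_origin Y"
  shows "\<exists>g A B. entire_family g (polar_G_part X Y m) A B"
proof -
  obtain M \<delta> where M: "M > 0" "\<delta> > 0"
    "\<And>i j. \<bar>taylor_coeff X (i, j)\<bar> \<le> M / \<delta> ^ (i + j)" "\<And>i j. \<bar>taylor_coeff Y (i, j)\<bar> \<le> M / \<delta> ^ (i + j)"
    using common_taylor_coeff_growth[OF assms] by blast
  have X: "\<bar>(\<lambda>p. - taylor_coeff X p) (i, j)\<bar> \<le> M / \<delta> ^ (i + j)" for i j
    using M(3) by simp
  have "trig_form (taylor_coeff Y) (\<lambda>p. - taylor_coeff X p) (k + m) (of_real t) =
      of_real (polar_G_part X Y m k t)" for k t
    by (simp add: trig_form_def polar_G_part_def homogeneous_part_def cos_of_real sin_of_real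
        sum_distrib_left sum_distrib_right right_diff_distrib sum_subtractf mult_ac)
  from entire_family_trig_form[OF M(1,2,4) X this] show ?thesis
    by blast
qed

lemma valid_indices_nonempty:
  assumes fam: "entire_family g \<gamma> A B" and F: "F = (\<lambda>(r, t). \<Sum>k. \<gamma> k t * r ^ k)"
    and nz: "\<gamma> k t \<noteq> 0"
  shows "valid_indices F \<noteq> {}"
proof
  interpret entire_family g \<gamma> A B by (rule fam)
  assume "valid_indices F = {}"
  then have 0: "taylor_coeff F p = 0" for p
    unfolding valid_indices_def by blast
  have "has_power_series F (taylor_coeff F)"
    using analytic unfolding F by (rule has_power_series_taylor_coeff)
  then have "\<forall>\<^sub>F z in nhds (0, 0). F z = 0"
    unfolding has_power_series_def
    by (rule eventually_mono) (auto simp: 0 case_prod_beta dest: has_sum_unique[OF _ has_sum_0])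
  then have "\<forall>\<^sub>F (r, t) in nhds (0, 0). (\<Sum>k. \<gamma> k t * r ^ k) = 0"
    unfolding F by (rule eventually_mono) auto
  then show False
    using vanishes_if_sum_vanishes nz by blast
qed

lemma eventually_axis:
  assumes "\<forall>\<^sub>F z in nhds ((0 :: real), (0 :: real)). P z"
  shows "\<forall>\<^sub>F r in nhds 0. P (r, 0)"
proof -
  have "filterlim (\<lambda>r :: real. (r, 0 :: real)) (nhds (0, 0)) (nhds 0)"
    by (intro tendsto_intros filterlim_ident)
  then show ?thesis
    using assms by (rule eventually_compose_filterlim[rotated])
qed

lemma power_series_on_axis:
  assumes "has_power_series F a"
  shows "\<forall>\<^sub>F r in nhds 0. ((\<lambda>i. a (i, 0) * r ^ i) sums F (r, 0))"
proof -
  have *: "(\<lambda>i. a (i, 0) * r ^ i) sums F (r, 0)"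
    if "((\<lambda>(i, j). a (i, j) * r ^ i * 0 ^ j) has_sum F (r, 0)) UNIV" for r
  proof (rule has_sum_imp_sums)
    have "((\<lambda>(i, j). a (i, j) * r ^ i * 0 ^ j) has_sum F (r, 0)) (range (\<lambda>i :: nat. (i, 0 :: nat)))"
      using that by (subst (asm) has_sum_cong_neutral[where T = "range (\<lambda>i. (i, 0))"
            and g = "\<lambda>(i, j). a (i, j) * r ^ i * 0 ^ j"]) (auto simp: image_iff)
    then show "((\<lambda>i. a (i, 0) * r ^ i) has_sum F (r, 0)) UNIV"
      by (subst (asm) has_sum_reindex) (auto simp: inj_on_def o_def)
  qed
  have "\<forall>\<^sub>F r in nhds 0. ((\<lambda>(i, j). a (i, j) * r ^ i * 0 ^ j) has_sum F (r, 0)) UNIV"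
    using eventually_axis[OF assms[unfolded has_power_series_def]] by simp
  then show ?thesis
    by (rule eventually_mono) (rule *)
qed

lemma homogeneous_part_on_axis: "homogeneous_part F k 1 0 = taylor_coeff F (k, 0)"
proof -
  have "homogeneous_part F k 1 0 = (\<Sum>i\<le>k. if i = k then taylor_coeff F (k, 0) else 0)"
    unfolding homogeneous_part_def by (rule sum.cong) auto
  then show ?thesis by simp
qed

text \<open>At angle \<open>0\<close> the polar form is the vector field on the horizontal axis divided by \<open>r ^ m\<close>.\<close>

lemma component_on_axis:
  assumes F: "real_analytic_at_origin F"
    and lower: "\<And>k. k < m \<Longrightarrow> homogeneous_part F k 1 0 = 0"
  shows "\<forall>\<^sub>F r in nhds 0. r \<noteq> 0 \<longrightarrow>
    F (r, 0) = r ^ m * (\<Sum>k. homogeneous_part F (k + m) 1 0 * r ^ k)"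
  using power_series_on_axis[OF has_power_series_taylor_coeff[OF F]]
proof (rule eventually_mono, intro impI)
  fix r :: real
  assume s: "(\<lambda>i. taylor_coeff F (i, 0) * r ^ i) sums F (r, 0)" and "r \<noteq> 0"
  let ?h = "\<lambda>k. homogeneous_part F k 1 0"
  have "(\<lambda>i. ?h i * r ^ i) sums F (r, 0)"
    using s by (simp only: homogeneous_part_on_axis)
  moreover have "(\<Sum>i<m. ?h i * r ^ i) = 0"
    using lower by (intro sum.neutral) simp
  ultimately have "(\<lambda>k. ?h (k + m) * r ^ (k + m)) sums F (r, 0)"
    using sums_iff_shift'[of "\<lambda>i. ?h i * r ^ i" m "F (r, 0)"] by simp
  then have "(\<lambda>k. ?h (k + m) * r ^ (k + m) / r ^ m) sums (F (r, 0) / r ^ m)"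
    by (rule sums_divide)
  then have "(\<lambda>k. ?h (k + m) * r ^ k) sums (F (r, 0) / r ^ m)"
    using \<open>r \<noteq> 0\<close> by (simp add: power_add)
  from sums_unique[OF this] show "F (r, 0) = r ^ m * (\<Sum>k. ?h (k + m) * r ^ k)"
    using \<open>r \<noteq> 0\<close> by (simp add: divide_eq_eq mult.commute)
qed

lemma zero_on_axis:
  assumes "entire_family g \<gamma> A B" and F: "F = (\<lambda>(r, t). \<Sum>k. \<gamma> k t * r ^ k)"
    and pos: "\<And>q. q \<in> valid_indices F \<Longrightarrow> snd q \<noteq> 0"
  shows "\<forall>\<^sub>F r in nhds 0. (\<Sum>k. \<gamma> k 0 * r ^ k) = 0"
proof -
  have "has_power_series F (taylor_coeff F)"
    using entire_family.analytic[OF assms(1)] unfolding F by (rule has_power_series_taylor_coeff)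
  then have "\<forall>\<^sub>F r in nhds 0. (\<lambda>i. taylor_coeff F (i, 0) * r ^ i) sums F (r, 0)"
    by (rule power_series_on_axis)
  moreover have "taylor_coeff F (i, 0) = 0" for i
    using pos[of "(i, 0)"] by (auto simp: valid_indices_def)
  ultimately have "\<forall>\<^sub>F r in nhds 0. (\<lambda>i. 0) sums F (r, 0)"
    by simp
  then have "\<forall>\<^sub>F r in nhds 0. F (r, 0) = 0"
    by (rule eventually_mono) (rule sums_unique2[OF _ sums_zero])
  then show ?thesis
    by (simp add: F)
qed

section \<open>Counting roots by sign changes\<close>

lemma vertices_eq_map: "valid_indices F \<noteq> {} \<Longrightarrow> vertices F = map (vertex F) [0..<Suc (last_index F)]"
  by (rule nth_equalityI) (simp_all add: length_vertices vertex_def del: upt_Suc)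

lemma sign_changes_along_vertices:
  assumes "valid_indices F \<noteq> {}"
  shows "sign_changes (map f (vertices F)) =
    (\<Sum>k<last_index F. of_bool (f (vertex F (Suc k)) * f (vertex F k) < 0))"
  unfolding sign_changes_eq_sum using assms
  by (simp add: vertices_eq_map mult.commute del: upt_Suc)

lemma root_count_eq_sum:
  assumes "valid_indices F \<noteq> {}"
  shows "root_count F = (\<Sum>k<last_index F.
    card {\<theta>. \<theta> \<noteq> 0 \<and> poly (componential_poly F (slope_of_edge F k)) \<theta> = 0})"
  unfolding root_count_def slopes_eq by (simp add: sum.reindex[OF inj_on_slope_of_edge[OF assms]])

text \<open>At a slope of \<open>F\<close> the polynomial of \<open>K\<close> is a monomial, because \<open>K\<close> has no edge of that slope. Hence
the edge of \<open>F\<close> contributes one root for each sign change between its end vertices, once in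
\<open>vertex_coeffs\<close> and once in \<open>signed_vertex_coeffs\<close>. At the junction of the two sequences a
sign changes if and only if the last ordinate is odd, which by \<open>parity\<close> means that it is nonzero;
this is the case in which \<open>number_N\<close> counts one root more than \<open>root_count\<close>.\<close>

lemma number_N_eq_sign_changes:
  assumes F: "valid_indices F \<noteq> {}" and K: "valid_indices K \<noteq> {}"
    and NP: "slopes F \<inter> slopes K = {}"
    and Q: "\<And>\<xi> \<theta>. \<xi> \<in> slopes F \<Longrightarrow> \<theta> \<noteq> 0 \<Longrightarrow>
      poly (bracket (componential_poly F \<xi>) (componential_poly K \<xi>)) \<theta> \<noteq> 0"
    and parity: "snd (last_vertex F) \<noteq> 0 \<Longrightarrow> odd (snd (last_vertex F))"
  shows "number_N F = sign_changes (vertex_coeffs F @ signed_vertex_coeffs F)"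
proof -
  define c where "c = taylor_coeff F"
  define e where "e = (\<lambda>p. (- 1) ^ snd p * taylor_coeff F p)"
  let ?n = "last_index F"
  let ?v = "vertex F"
  have edge: "card {\<theta>. \<theta> \<noteq> 0 \<and> poly (componential_poly F (slope_of_edge F k)) \<theta> = 0} =
      of_bool (c (?v (Suc k)) * c (?v k) < 0) + of_bool (e (?v (Suc k)) * e (?v k) < 0)"
    if k: "k < ?n" for k
  proof -
    let ?\<xi> = "slope_of_edge F k" and ?p = "componential_poly F (slope_of_edge F k)"
    have \<xi>: "?\<xi> \<in> slopes F" "?\<xi> < 0"
      using k slope_of_edge_negative[OF F k] by (auto simp: slopes_eq)
    then obtain b j where K\<xi>: "componential_poly K ?\<xi> = monom b j"
      using componential_poly_at_vertex[OF K, of ?\<xi>] NP by blast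
    note p = componential_poly_at_edge[OF F k]
    have "?v (Suc k) \<in> valid_indices F"
      using k by (intro corner_valid vertex_in_corners[OF F]) simp
    then have low: "coeff ?p (snd (?v (Suc k))) \<noteq> 0"
      using p(1) by (simp add: valid_indices_def)
    have br: "poly (bracket ?p (monom b j)) \<theta> \<noteq> 0" if "\<theta> \<noteq> 0" for \<theta>
      using Q[OF \<xi>(1) that] unfolding K\<xi> .
    show ?thesis
      using card_nonzero_roots[OF low p(2) br] unfolding p(1,4) unfolding p(3)
      by (simp add: c_def e_def)
  qed
  have "root_count F = (\<Sum>k<?n. of_bool (c (?v (Suc k)) * c (?v k) < 0)) +
      (\<Sum>k<?n. of_bool (e (?v (Suc k)) * e (?v k) < 0))"
    unfolding root_count_eq_sum[OF F] sum.distrib[symmetric] by (rule sum.cong) (simp_all add: edge)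
  also have "\<dots> = sign_changes (vertex_coeffs F) + sign_changes (signed_vertex_coeffs F)"
    unfolding sign_changes_along_vertices[OF F, symmetric]
    by (simp add: vertex_coeffs_def signed_vertex_coeffs_def sign_changes_rev c_def e_def)
  finally have roots: "root_count F = sign_changes (vertex_coeffs F) + sign_changes (signed_vertex_coeffs F)" .
  have last: "last (vertex_coeffs F) = c (last_vertex F)" "hd (signed_vertex_coeffs F) = e (last_vertex F)"
    and ne: "vertex_coeffs F \<noteq> []" "signed_vertex_coeffs F \<noteq> []"
    by (simp_all add: vertex_coeffs_def signed_vertex_coeffs_def vertices_eq_map[OF F] last_vertex_def c_def e_def)
  have "last_vertex F \<in> valid_indices F"
    unfolding last_vertex_def by (intro corner_valid vertex_in_corners[OF F]) simp
  then have "c (last_vertex F) * c (last_vertex F) > 0"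
    unfolding valid_indices_def c_def by (simp flip: not_real_square_gt_zero)
  then have "c (last_vertex F) * e (last_vertex F) < 0 \<longleftrightarrow> odd (snd (last_vertex F))"
    unfolding e_def c_def[symmetric] by (cases "even (snd (last_vertex F))") (auto simp: not_less less_imp_le)
  then show ?thesis
    using parity sign_changes_append[OF ne] roots unfolding last number_N_def
    by (cases "snd (last_vertex F) = 0") simp_all
qed

lemma bracket_swap: "bracket q p = - bracket p q"
  by (simp add: bracket_def mult.commute)

theorem corollary2p1:
  fixes X Y G H :: "real \<times> real \<Rightarrow> real" and m :: nat
  assumes analytic: "real_analytic_at_origin X" "real_analytic_at_origin Y"
    and m: "m \<ge> 2"
    and lower_parts: "\<And>k x y. k < m \<Longrightarrow> homogeneous_part X k x y = 0 \<and> homogeneous_part Y k x y = 0"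
    and lowest_part: "\<exists>x y. (homogeneous_part X m x y)\<^sup>2 + (homogeneous_part Y m x y)\<^sup>2 \<noteq> 0"
    and singular: "X (0, 0) = 0" "Y (0, 0) = 0"
    and isolated: "\<forall>\<^sub>F z in at (0, 0). (X z, Y z) \<noteq> (0, 0)"
    and G: "G = polar_G X Y m"
    and H: "H = polar_H X Y m"
    and G_nonzero: "\<exists>k \<theta>. polar_G_part X Y m k \<theta> \<noteq> 0"
    and H_nonzero: "\<exists>k \<theta>. polar_H_part X Y m k \<theta> \<noteq> 0"
    and exceptional: "polar_G_part X Y m 0 0 = 0" "polar_H_part X Y m 0 0 = 0"
    and NP: "slopes G \<inter> slopes H = {}"
    and cases: "(snd (last_vertex G) + snd (last_vertex H) > 0 \<and> cond_P1 G H \<and> cond_Q G H) \<or>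
      (snd (last_vertex G) = 0 \<and> snd (last_vertex H) = 0 \<and>
        cond_P2 G H \<and> cond_Q G H \<and> cond_S G H \<and>
        (cond_H1 G H \<or> cond_H2 G H \<or> cond_H3 G H \<or> cond_H4 G H))"
  shows "number_N G = sign_changes (vertex_coeffs G @ signed_vertex_coeffs G) \<and>
         number_N H = sign_changes (vertex_coeffs H @ signed_vertex_coeffs H)"
proof -
  obtain gG AG BG where famG: "entire_family gG (polar_G_part X Y m) AG BG"
    using entire_family_polar_G[OF analytic] by blast
  obtain gH AH BH where famH: "entire_family gH (polar_H_part X Y m) AH BH"
    using entire_family_polar_H[OF analytic] by blast
  have G': "G = (\<lambda>(r, t). \<Sum>k. polar_G_part X Y m k t * r ^ k)"
    and H': "H = (\<lambda>(r, t). \<Sum>k. polar_H_part X Y m k t * r ^ k)"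
    by (simp_all add: G H polar_G_def polar_H_def)
  have neG: "valid_indices G \<noteq> {}"
    using valid_indices_nonempty[OF famG G'] G_nonzero by blast
  have neH: "valid_indices H \<noteq> {}"
    using valid_indices_nonempty[OF famH H'] H_nonzero by blast
  \<comment> \<open>Otherwise \<open>G\<close> and \<open>H\<close> both vanish for angle \<open>0\<close>, and the vector field is zero along an axis.\<close>
  have on_axis: "snd (last_vertex G) = 0 \<or> snd (last_vertex H) = 0"
  proof (rule ccontr)
    assume "\<not> ?thesis"
    then have "\<And>q. q \<in> valid_indices G \<Longrightarrow> snd q \<noteq> 0" "\<And>q. q \<in> valid_indices H \<Longrightarrow> snd q \<noteq> 0"
      using last_vertex_is_lowest by force+
    then have "\<forall>\<^sub>F r in nhds 0. (\<Sum>k. polar_G_part X Y m k 0 * r ^ k) = 0"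
      "\<forall>\<^sub>F r in nhds 0. (\<Sum>k. polar_H_part X Y m k 0 * r ^ k) = 0"
      using zero_on_axis[OF famG G'] zero_on_axis[OF famH H'] by blast+
    moreover have "\<forall>\<^sub>F r in nhds 0. r \<noteq> 0 \<longrightarrow> X (r, 0) = r ^ m * (\<Sum>k. homogeneous_part X (k + m) 1 0 * r ^ k)"
      "\<forall>\<^sub>F r in nhds 0. r \<noteq> 0 \<longrightarrow> Y (r, 0) = r ^ m * (\<Sum>k. homogeneous_part Y (k + m) 1 0 * r ^ k)"
      using lower_parts by (auto intro!: component_on_axis analytic)
    ultimately have "\<forall>\<^sub>F r in nhds 0. r \<noteq> 0 \<longrightarrow> X (r, 0) = 0 \<and> Y (r, 0) = 0"
      by eventually_elim (simp add: polar_G_part_def polar_H_part_def)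
    moreover have "\<forall>\<^sub>F r in nhds (0 :: real). (r, 0 :: real) \<noteq> (0, 0) \<longrightarrow> (X (r, 0), Y (r, 0)) \<noteq> (0, 0)"
      using eventually_axis[OF isolated[unfolded eventually_at_filter]] by simp
    ultimately have "\<forall>\<^sub>F r in nhds (0 :: real). r = 0"
      by eventually_elim auto
    then have "\<forall>\<^sub>F r in at (0 :: real). False"
      unfolding eventually_at_filter by eventually_elim simp
    then show False
      by simp
  qed
  have Q: "poly (bracket (componential_poly G \<xi>) (componential_poly H \<xi>)) \<theta> \<noteq> 0"
    "poly (bracket (componential_poly H \<xi>) (componential_poly G \<xi>)) \<theta> \<noteq> 0"
    if "\<xi> \<in> slopes G \<union> slopes H" "\<theta> \<noteq> 0" for \<xi> \<theta>
    using cases that bracket_swap[of "componential_poly H \<xi>" "componential_poly G \<xi>"]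
    unfolding cond_Q_def by auto
  \<comment> \<open>Without common slopes the only block is the whole vertex sequence.\<close>
  have parities: "odd (snd (last_vertex G)) \<longleftrightarrow> even (snd (last_vertex H))" if "cond_P1 G H"
  proof -
    have "common_slopes G H = []"
      by (simp add: common_slopes_def NP)
    then have "opposite_parities (block G [] 0) (block H [] 0)"
      using that by (simp add: cond_P1_def)
    moreover have "last_vertex F \<in> set (block F [] 0)" for F
      by (simp add: block_def cut_index_def last_vertex_def)
    ultimately show ?thesis
      unfolding opposite_parities_def by blast
  qed
  have "snd (last_vertex G) \<noteq> 0 \<Longrightarrow> odd (snd (last_vertex G))"
    "snd (last_vertex H) \<noteq> 0 \<Longrightarrow> odd (snd (last_vertex H))"
    using cases on_axis parities by auto
  then show ?thesis
    using number_N_eq_sign_changes[OF neG neH NP] number_N_eq_sign_changes[OF neH neG] Q NP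
    by (simp add: Int_commute)
qed

end
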